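(* Let $\Lambda$ be an open subset of $\mathbb{R}^d$ and consider a continuous family $\{f_\mu\}_{\mu\in\Lambda}$ of analytic functions on $[0,+\infty)$ such that $f_\mu(x)\sim_{\infty}a(\mu)x^{\alpha(\mu)}$ at $\hat\mu\in\Lambda$. Assume that there exists $m\in\mathbb{N}\cup\{0\}$ such that $\alpha(\hat\mu)+2m=-1$. If $M_1[f_\mu]\equiv M_2[f_\mu]\equiv\cdots\equiv M_m[f_\mu]\equiv0$ (identically as functions of $\mu$; this condition is void if $m=0$), then $$x^{2m+1}\,\mathscr F[f_\mu](x)\sim_{\infty}a(\mu)\,b_m(\alpha(\mu))\,\Omega(x,\alpha(\mu)+2m)\quad\text{at }\hat\mu.$$
   Context: $\mathbb{N}=\{1,2,\dots\}$. An analytic function on $[0,+\infty)$ (the class $C^\omega[0,+\infty)$) is an analytic function on $(0,+\infty)$ that extends analytically to $x=0$. A family $\{f_\mu\}$ is continuous if $(x,\mu)\mapsto f_\mu(x)$ is continuous. Operator: $\mathscr F[f](x):=\int_0^{\pi/2}f(x\sin\theta)\,d\theta$. Momenta: $M_n[f]:=\int_0^{+\infty}x^{2n-2}f(x)\,dx$ for $n\in\mathbb{N}$, whenever well defined. $b_0(\alpha)\equiv1$ and $b_m(\alpha):=\prod_{i=1}^m\frac{\alpha+2i}{\alpha+2i-1}$ for $m\ge1$. Quantification by powers: $f_\mu(x)\sim_\infty a(\mu)x^{\alpha(\mu)}$ at $\hat\mu$ means that there is an open neighborhood $U$ of $\hat\mu$ such that for each $\mu\in U$, $\lim_{x\to+\infty}f_\mu(x)x^{-\alpha(\mu)}=a(\mu)\ne0$,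 and moreover $\lim_{(x,\mu)\to(+\infty,\hat\mu)}f_\mu(x)x^{-\alpha(\mu)}=a(\hat\mu)\neq 0$. Compensator: $\omega(x,\alpha):=\frac{x^{\alpha+1}-1}{\alpha+1}$ if $\alpha\ne-1$ and $\omega(x,-1):=\log x$, for $x>0$. Let $\mathscr G(\alpha):=\frac{\sqrt\pi}{2}\frac{\Gamma(\frac{1+\alpha}{2})}{\Gamma(1+\frac\alpha2)}$ ($\Gamma$ the Gamma function) and $\Omega(x,\alpha):=(\alpha+1)\mathscr G(\alpha)\omega(x,\alpha)$, where $(\alpha+1)\mathscr G(\alpha)=\sqrt\pi\,\Gamma(\frac{3+\alpha}{2})/\Gamma(1+\frac\alpha2)$ is continuously extended to $\alpha=-1$ with value $1$ (so $\Omega(x,-1)=\log x$). Quantification by $\Omega$: for a continuous family $\{F_\mu\}$ and a function $\beta(\mu)$, $F_\mu(x)\sim_\infty\ell(\mu)\Omega(x,\beta(\mu))$ at $\hat\mu$ means $\lim_{(x,\mu)\to(+\infty,\hat\mu)}\frac{F_\mu(x)}{\Omega(x,\beta(\mu))}=\ell(\hat\mu)\ne0$. *)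

theory Defs
  imports "HOL-Analysis.Analysis"
begin

text \<open>Intended for open sets \<open>S\<close>: the expansion is required on a full interval around each point.\<close>

definition real_analytic_on :: "(real \<Rightarrow> real) \<Rightarrow> real set \<Rightarrow> bool" where
  "real_analytic_on f S \<longleftrightarrow>
     (\<forall>x0\<in>S. \<exists>r>0. \<exists>c :: nat \<Rightarrow> real. \<forall>x. \<bar>x - x0\<bar> < r \<longrightarrow> (\<lambda>n. c n * (x - x0) ^ n) sums f x)"

text \<open>
  The class \<open>C\<^sup>\<omega>[0,+\<infinity>)\<close>. Functions on \<open>[0,+\<infinity>)\<close> are represented by total functions whose
  values on the negative half-line are irrelevant, hence the local extension \<open>g\<close> at the origin.
\<close>

definition analytic_halfline :: "(real \<Rightarrow> real) \<Rightarrow> bool" where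
  "analytic_halfline f \<longleftrightarrow>
     real_analytic_on f {0<..} \<and>
     (\<exists>e>0. \<exists>g. real_analytic_on g {-e<..<e} \<and> (\<forall>x\<in>{0..<e}. f x = g x))"

definition F_op :: "(real \<Rightarrow> real) \<Rightarrow> real \<Rightarrow> real" where
  "F_op f x = integral {0..pi/2} (\<lambda>\<theta>. f (x * sin \<theta>))"

text \<open>
  For continuous integrands, Henstock-Kurzweil integrability on \<open>[0,+\<infinity>)\<close> is convergence of the
  improper integral. The exponent is meant for \<open>n \<ge> 1\<close>.
\<close>

definition momentum_exists :: "nat \<Rightarrow> (real \<Rightarrow> real) \<Rightarrow> bool" where
  "momentum_exists n f \<longleftrightarrow> (\<lambda>x. x ^ (2 * n - 2) * f x) integrable_on {0..}"

definition momentum :: "nat \<Rightarrow> (real \<Rightarrow> real) \<Rightarrow> real" where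
  "momentum n f = integral {0..} (\<lambda>x. x ^ (2 * n - 2) * f x)"

definition b_coeff :: "nat \<Rightarrow> real \<Rightarrow> real" where
  "b_coeff m \<alpha> = (\<Prod>i=1..m. (\<alpha> + 2 * real i) / (\<alpha> + 2 * real i - 1))"

text \<open>
  Below, the joint limit \<open>(x,\<mu>) \<rightarrow> (+\<infinity>,\<mu>0)\<close> is taken along \<open>at_top \<times>\<^sub>F nhds \<mu>0\<close>, so that
  the parameter value \<open>\<mu>0\<close> itself is not excluded.
\<close>

definition quantified_by_powers ::
    "'p::topological_space set \<Rightarrow> ('p \<Rightarrow> real \<Rightarrow> real) \<Rightarrow> ('p \<Rightarrow> real) \<Rightarrow> ('p \<Rightarrow> real) \<Rightarrow> 'p \<Rightarrow> bool" where
  "quantified_by_powers \<Lambda> f a \<alpha> \<mu>0 \<longleftrightarrow>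
     (\<exists>U. open U \<and> \<mu>0 \<in> U \<and> U \<subseteq> \<Lambda> \<and>
        (\<forall>\<mu>\<in>U. ((\<lambda>x. f \<mu> x * x powr (- \<alpha> \<mu>)) \<longlongrightarrow> a \<mu>) at_top \<and> a \<mu> \<noteq> 0)) \<and>
     ((\<lambda>(x, \<mu>). f \<mu> x * x powr (- \<alpha> \<mu>)) \<longlongrightarrow> a \<mu>0) (at_top \<times>\<^sub>F nhds \<mu>0) \<and> a \<mu>0 \<noteq> 0"

definition compensator :: "real \<Rightarrow> real \<Rightarrow> real" where
  "compensator x \<alpha> = (if \<alpha> = -1 then ln x else (x powr (\<alpha> + 1) - 1) / (\<alpha> + 1))"

definition G_fun :: "real \<Rightarrow> real" where
  "G_fun \<alpha> = sqrt pi / 2 * (Gamma ((1 + \<alpha>) / 2) / Gamma (1 + \<alpha> / 2))"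

text \<open>The value at \<open>\<alpha> = -1\<close> is the continuous extension of \<open>(\<alpha> + 1) * G_fun \<alpha>\<close>.\<close>

definition Omega :: "real \<Rightarrow> real \<Rightarrow> real" where
  "Omega x \<alpha> = (if \<alpha> = -1 then 1 else (\<alpha> + 1) * G_fun \<alpha>) * compensator x \<alpha>"

definition quantified_by_Omega ::
    "('p::topological_space \<Rightarrow> real \<Rightarrow> real) \<Rightarrow> ('p \<Rightarrow> real) \<Rightarrow> ('p \<Rightarrow> real) \<Rightarrow> 'p \<Rightarrow> bool" where
  "quantified_by_Omega F l \<beta> \<mu>0 \<longleftrightarrow>
     ((\<lambda>(x, \<mu>). F \<mu> x / Omega x (\<beta> \<mu>)) \<longlongrightarrow> l \<mu>0) (at_top \<times>\<^sub>F nhds \<mu>0) \<and> l \<mu>0 \<noteq> 0"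

end

theory Submission
  imports Defs
begin

text \<open>
  Put \<open>\<beta> = \<alpha> + 2 m\<close>, so \<open>\<beta> \<rightarrow> -1\<close>, and let \<open>c\<^sub>k\<close> be the Taylor coefficients of \<open>(1 - v) powr (-1/2)\<close>.
  Cut the integral defining \<open>F_op f x\<close> at \<open>\<theta> = \<pi>/6\<close>. The outer piece only sees \<open>f\<close> on \<open>[x/2, x]\<close>.
  On the inner piece write \<open>1 = cos \<theta> (\<Sum>k\<le>m. c\<^sub>k (sin \<theta>)^(2k)) + O((sin \<theta>)^(2m+2))\<close> and substitute
  \<open>s = x sin \<theta>\<close>: this produces the truncated moments \<open>\<integral>\<^sub>0\<^bsup>x/2\<^esup> s^(2k) f(s) ds\<close>. For \<open>k < m\<close> they are tails,
  because the full moments vanish. So, uniformly in the parameter,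
  \<open>x^(2m+1) F_op f x = c\<^sub>m \<integral>\<^sub>0\<^bsup>x\<^esup> s^(2m) f(s) ds + O(1 + x powr (\<beta>+1))\<close>.

  The integral on the right is asymptotic to \<open>a \<omega>(x, \<beta>)\<close>, since \<open>\<omega>\<close> is the integral of \<open>s powr \<beta>\<close> from 1
  to \<open>x\<close>; the error is negligible because \<open>1/\<omega>(x, \<beta>)\<close> and \<open>(x powr (\<beta>+1))/\<omega>(x, \<beta>)\<close> are at most
  \<open>1/ln x + \<bar>\<beta> + 1\<bar>\<close>. Finally \<open>c\<^sub>m = b\<^sub>m(-1-2m)\<close> and \<open>\<Omega>/\<omega> \<rightarrow> 1\<close>. Continuity of \<open>\<alpha>\<close> at the base point
  is a consequence of the joint limit and the continuity of the family.
\<close>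

subsection \<open>Taylor coefficients of the inverse square root\<close>

text \<open>This is \<open>(2n choose n) / 4^n\<close>; the Pochhammer form makes positivity
  immediate and matches the product in \<open>b_coeff\<close>.\<close>

definition inv_sqrt_coeff :: "nat \<Rightarrow> real" where
  "inv_sqrt_coeff n = pochhammer (1/2) n / fact n"

lemma inv_sqrt_coeff_pos: "0 < inv_sqrt_coeff n"
  by (simp add: inv_sqrt_coeff_def pochhammer_pos)

lemma inv_sqrt_coeff_nonneg: "0 \<le> inv_sqrt_coeff n"
  using inv_sqrt_coeff_pos[of n] by simp

lemma inv_sqrt_coeff_sums:
  assumes "\<bar>v\<bar> < 1"
  shows "(\<lambda>n. inv_sqrt_coeff n * v ^ n) sums (1 / sqrt (1 - v))"
proof -
  have "(\<lambda>n. ((-1/2) gchoose n) * (-v) ^ n) sums (1 + (-v)) powr (-1/2)"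
    using assms by (intro gen_binomial_real) auto
  \<comment> \<open>The generalized binomial coefficient carries the sign (-1)^n, which cancels that
    of (-v)^n.\<close>
  moreover have "((-1/2) gchoose n) * (-v) ^ n = inv_sqrt_coeff n * v ^ n" for n
  proof -
    have "(-v) ^ n = (-1) ^ n * v ^ n" "(-1) ^ n * (-1) ^ n = (1::real)"
      using power_mult_distrib[of "-1" v n] by (simp, simp)
    then show ?thesis
      by (simp add: gbinomial_pochhammer inv_sqrt_coeff_def)
  qed
  moreover have "(1 + (-v)) powr (-1/2) = 1 / sqrt (1 - v)"
    using assms by (simp add: powr_minus_divide powr_half_sqrt)
  ultimately show ?thesis
    by simp
qed

text \<open>All coefficients are nonnegative, so the tail divided by \<open>v ^ Suc m\<close> is a
  power series increasing in v, and its value at v = 1/4 serves as K. The endpoint 1/4 is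
  sin^2(pi/6), the value at the cut.\<close>

lemma inv_sqrt_coeff_remainder:
  obtains K where "0 \<le> K"
    "\<And>v. 0 \<le> v \<Longrightarrow> v \<le> 1/4 \<Longrightarrow>
       \<bar>1 / sqrt (1 - v) - (\<Sum>k\<le>m. inv_sqrt_coeff k * v ^ k)\<bar> \<le> K * v ^ Suc m"
proof -
  define g where "g v n = inv_sqrt_coeff (n + Suc m) * v ^ n" for v n
  have tail: "(\<lambda>n. v ^ Suc m * g v n) sums (1 / sqrt (1 - v) - (\<Sum>k\<le>m. inv_sqrt_coeff k * v ^ k))"
    if "0 \<le> v" "v \<le> 1/4" for v
    using sums_split_initial_segment[OF inv_sqrt_coeff_sums, of v "Suc m"] that
    by (simp add: g_def power_add mult_ac lessThan_Suc_atMost)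
  have summ: "summable (g v)" if "0 < v" "v \<le> 1/4" for v
    using sums_summable[OF tail[of v]] that by (simp add: summable_cmult_iff del: power_Suc)
  have gpos: "0 \<le> g v n" if "0 \<le> v" for v n
    using that by (simp add: g_def inv_sqrt_coeff_nonneg)
  show thesis
  proof
    show "0 \<le> suminf (g (1/4))"
      by (intro suminf_nonneg summ gpos) auto
    fix v :: real assume v: "0 \<le> v" "v \<le> 1/4"
    show "\<bar>1 / sqrt (1 - v) - (\<Sum>k\<le>m. inv_sqrt_coeff k * v ^ k)\<bar> \<le> suminf (g (1/4)) * v ^ Suc m"
    \<comment> \<open>Summability of \<open>g v\<close> comes from cancelling
      \<open>v ^ Suc m\<close>, which is only possible for v > 0.\<close>
    proof (cases "v = 0")
      case True
      with tail[of 0] show ?thesis by (simp add: sums_iff)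
    next
      case False
      with v have v': "0 < v" by simp
      have "suminf (g v) \<le> suminf (g (1/4))"
        using v by (intro suminf_le summ v')
          (auto simp: g_def intro!: mult_left_mono power_mono inv_sqrt_coeff_nonneg)
      moreover have "1 / sqrt (1 - v) - (\<Sum>k\<le>m. inv_sqrt_coeff k * v ^ k) = v ^ Suc m * suminf (g v)"
        using tail[OF v] sums_unique suminf_mult[OF summ[OF v' v(2)]] by metis
      moreover have "0 \<le> suminf (g v)"
        using v by (intro suminf_nonneg summ v' gpos) auto
      ultimately show ?thesis
        using v by (simp add: abs_mult mult.commute[of _ "v ^ Suc m"] mult_left_mono del: power_Suc)
    qed
  qed
qed

text \<open>With v = sin^2 \<theta> the inverse square root is 1 / cos \<theta>; the remainder bound
  is multiplied by cos \<theta> \<le> 1. The factor cos \<theta> kept in each summand is the one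
  that the substitution s = x sin \<theta> requires.\<close>

lemma one_minus_cos_sin_sum_bound:
  obtains K where "0 \<le> K"
    "\<And>\<theta>. 0 \<le> \<theta> \<Longrightarrow> \<theta> \<le> pi/6 \<Longrightarrow>
       \<bar>1 - (\<Sum>k\<le>m. inv_sqrt_coeff k * (sin \<theta> ^ (2*k) * cos \<theta>))\<bar> \<le> K * sin \<theta> ^ (2*m+2)"
proof -
  obtain K where K: "0 \<le> K" "\<And>v. 0 \<le> v \<Longrightarrow> v \<le> 1/4 \<Longrightarrow>
       \<bar>1 / sqrt (1 - v) - (\<Sum>k\<le>m. inv_sqrt_coeff k * v ^ k)\<bar> \<le> K * v ^ Suc m"
    using inv_sqrt_coeff_remainder[of m] by blast
  show thesis
  proof
    fix \<theta> :: real assume \<theta>: "0 \<le> \<theta>" "\<theta> \<le> pi/6"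
    have s: "0 \<le> sin \<theta>" "sin \<theta> \<le> 1/2"
      using \<theta> sin_monotone_2pi_le[of \<theta> "pi/6"] by (auto simp: sin_ge_zero sin_30)
    have c: "0 < cos \<theta>"
      using \<theta> pi_gt_zero by (intro cos_gt_zero_pi) linarith+
    have sq: "sqrt (1 - (sin \<theta>)\<^sup>2) = cos \<theta>"
      using c by (simp add: flip: cos_squared_eq)
    have "(sin \<theta>)\<^sup>2 \<le> (1/2)\<^sup>2"
      using s by (intro power_mono)
    then have le: "(sin \<theta>)\<^sup>2 \<le> 1/4"
      by (simp add: power2_eq_square)
    have "\<bar>1 - (\<Sum>k\<le>m. inv_sqrt_coeff k * (sin \<theta> ^ (2*k) * cos \<theta>))\<bar>
        = cos \<theta> * \<bar>1 / cos \<theta> - (\<Sum>k\<le>m. inv_sqrt_coeff k * ((sin \<theta>)\<^sup>2) ^ k)\<bar>"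
      using c by (subst abs_mult_pos') (auto simp: right_diff_distrib sum_distrib_left mult_ac simp flip: power_mult)
    also have "\<dots> \<le> 1 * (K * ((sin \<theta>)\<^sup>2) ^ Suc m)"
      using K(2)[of "(sin \<theta>)\<^sup>2"] le c by (intro mult_mono) (auto simp: sq)
    also have "1 * (K * ((sin \<theta>)\<^sup>2) ^ Suc m) = K * sin \<theta> ^ (2*m+2)"
      using power_mult[of "sin \<theta>" 2 "Suc m"] by simp
    finally show "\<bar>1 - (\<Sum>k\<le>m. inv_sqrt_coeff k * (sin \<theta> ^ (2*k) * cos \<theta>))\<bar> \<le> K * sin \<theta> ^ (2*m+2)" .
  qed (fact K)
qed

text \<open>Numerator and denominator of the i-th factor are both negative here, with quotient (m -
  i + 1/2) / (m - i + 1). Reversing the index gives the Pochhammer product over the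
  factorial.\<close>

lemma b_coeff_at_resonance: "b_coeff m (- 1 - 2 * real m) = inv_sqrt_coeff m"
proof -
  have "b_coeff m (- 1 - 2 * real m) = (\<Prod>i=1..m. (1/2 + real (m - i)) / real (Suc (m - i)))"
    unfolding b_coeff_def by (intro prod.cong) (auto simp: field_simps of_nat_diff)
  also have "\<dots> = (\<Prod>i<m. (1/2 + real i) / real (Suc i))"
    by (rule prod.reindex_bij_witness[of _ "\<lambda>i. m - i" "\<lambda>i. m - i"]) auto
  also have "\<dots> = inv_sqrt_coeff m"
    by (simp add: inv_sqrt_coeff_def pochhammer_prod prod_dividef fact_prod_Suc atLeast0LessThan)
  finally show ?thesis .
qed

subsection \<open>Reduction to a truncated moment\<close>

text \<open>The power \<open>x ^ Suc n\<close> collects n factors from sin^n and one from the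
  Jacobian x cos \<theta>; the upper limit is x sin(pi/6) = x/2.\<close>

lemma integral_sin_substitution:
  fixes f :: "real \<Rightarrow> real"
  assumes "continuous_on {0..} f" "0 < x"
  shows "((\<lambda>\<theta>. f (x * sin \<theta>) * (sin \<theta> ^ n * cos \<theta>)) has_integral
            integral {0..x/2} (\<lambda>s. s ^ n * f s) / x ^ Suc n) {0..pi/6}"
proof -
  have "((\<lambda>\<theta>. (x * cos \<theta>) *\<^sub>R ((x * sin \<theta>) ^ n * f (x * sin \<theta>))) has_integral
          integral {x * sin 0..x * sin (pi/6)} (\<lambda>s. s ^ n * f s)) {0..pi/6}"
  proof (rule has_integral_substitution)
    show "x * sin 0 \<le> x * sin (pi/6)"
      using assms by (simp add: sin_30)
    show "(\<lambda>\<theta>. x * sin \<theta>) ` {0..pi/6} \<subseteq> {0..x}"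
      using assms by (auto simp: sin_ge_zero mult_left_le)
    show "continuous_on {0..x} (\<lambda>s. s ^ n * f s)"
      using assms by (intro continuous_intros continuous_on_subset[OF assms(1)]) auto
    show "((\<lambda>\<theta>. x * sin \<theta>) has_real_derivative x * cos \<theta>) (at \<theta> within {0..pi/6})" for \<theta>
      by (auto intro!: derivative_eq_intros)
  qed auto
  from has_integral_mult_right[OF this, of "1 / x ^ Suc n"] show ?thesis
    using assms by (simp add: sin_30 power_mult_distrib field_simps)
qed

text \<open>A single C for both ranges lets uniformity in the parameter be expressed as a common
  constant. The range [0,1] is separate because \<open>0 powr \<gamma>\<close> is 0, so the power
  bound would force f 0 = 0.\<close>

definition power_dominated :: "(real \<Rightarrow> real) \<Rightarrow> real \<Rightarrow> real \<Rightarrow> bool" where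
  "power_dominated f \<gamma> C \<longleftrightarrow> continuous_on {0..} f \<and>
     (\<forall>s\<in>{0..1}. \<bar>f s\<bar> \<le> C) \<and> (\<forall>s\<ge>1. \<bar>f s\<bar> \<le> C * s powr \<gamma>)"

lemma power_dominatedD:
  assumes "power_dominated f \<gamma> C"
  shows "continuous_on {0..} f"
    and "0 \<le> s \<Longrightarrow> s \<le> 1 \<Longrightarrow> \<bar>f s\<bar> \<le> C"
    and "1 \<le> s \<Longrightarrow> \<bar>f s\<bar> \<le> C * s powr \<gamma>"
    and "0 \<le> C"
  using assms by (auto simp: power_dominated_def dest: bspec[of _ _ 0])

lemma power_dominated_mult_power:
  assumes "power_dominated f \<gamma> C" "1 \<le> s"
  shows "\<bar>s ^ n * f s\<bar> \<le> C * s powr (\<gamma> + real n)"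
  using mult_left_mono[OF power_dominatedD(3)[OF assms], of "s ^ n"] assms(2)
  by (simp add: abs_mult powr_add powr_realpow mult_ac)

lemma continuous_on_mult_power:
  fixes f :: "real \<Rightarrow> real"
  assumes "continuous_on {0..} f" "S \<subseteq> {0..}"
  shows "continuous_on S (\<lambda>s. s ^ n * f s)"
  using assms by (intro continuous_intros continuous_on_subset[OF assms(1)])

text \<open>Comparison with a power of exponent e. Asking for e \<le> -2 rather than e < -1 gives 1
  / -(e + 1) \<le> 1, so the constant does not depend on e.\<close>

lemma power_dominated_tail:
  assumes f: "power_dominated f \<gamma> C" and n: "\<gamma> + real n \<le> -2" and X: "1 \<le> X"
  shows "(\<lambda>s. s ^ n * f s) integrable_on {X..}"
    and "\<bar>integral {X..} (\<lambda>s. s ^ n * f s)\<bar> \<le> C * X powr (\<gamma> + real n + 1)"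
proof -
  let ?e = "\<gamma> + real n"
  have I: "((\<lambda>s. C * s powr ?e) has_integral C * (- (X powr (?e + 1)) / (?e + 1))) {X..}"
    using n X by (intro has_integral_mult_right has_integral_powr_to_inf) auto
  have bnd: "\<bar>s ^ n * f s\<bar> \<le> C * s powr ?e" if "s \<in> {X..}" for s
    using power_dominated_mult_power[OF f] that X by auto
  show int: "(\<lambda>s. s ^ n * f s) integrable_on {X..}"
  proof (rule measurable_bounded_by_integrable_imp_integrable_real)
    show "(\<lambda>s. s ^ n * f s) \<in> borel_measurable (lebesgue_on {X..})"
      using X by (intro continuous_imp_measurable_on_sets_lebesgue
          continuous_on_mult_power power_dominatedD[OF f]) auto
  qed (use I bnd in \<open>auto simp: integrable_on_def\<close>)
  have "\<bar>integral {X..} (\<lambda>s. s ^ n * f s)\<bar> \<le> integral {X..} (\<lambda>s. C * s powr ?e)"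
    using integral_norm_bound_integral[OF int has_integral_integrable[OF I]] bnd by simp
  also have "\<dots> = C * (X powr (?e + 1) / - (?e + 1))"
    using integral_unique[OF I] n by (simp add: field_simps)
  also have "\<dots> \<le> C * X powr (?e + 1)"
    using n X power_dominatedD(4)[OF f]
    by (intro mult_left_mono) (auto simp: divide_le_eq mult_le_cancel_left1)
  finally show "\<bar>integral {X..} (\<lambda>s. s ^ n * f s)\<bar> \<le> C * X powr (?e + 1)" .
qed

text \<open>The decay makes the integral over the half-line converge, which discharges the premise
  of \<open>mom\<close>; the integral over [0,X] is then minus the tail beyond X. The index
  \<open>Suc k\<close> belongs to the exponent 2(k+1) - 2 = 2k.\<close>

lemma power_dominated_partial_moment:
  assumes f: "power_dominated f \<gamma> C" and k: "\<gamma> + 2 * real k \<le> -2" and X: "1 \<le> X"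
    and mom: "momentum_exists (Suc k) f \<Longrightarrow> momentum (Suc k) f = 0"
  shows "\<bar>integral {0..X} (\<lambda>s. s ^ (2 * k) * f s)\<bar> \<le> C * X powr (\<gamma> + 2 * real k + 1)"
proof -
  let ?g = "\<lambda>s. s ^ (2 * k) * f s"
  have k': "\<gamma> + real (2 * k) \<le> -2"
    using k by simp
  have 1: "?g integrable_on {0..X}"
    by (intro integrable_continuous_interval continuous_on_mult_power power_dominatedD[OF f]) auto
  note 2 = power_dominated_tail[OF f k' X]
  have "(?g has_integral integral {0..X} ?g + integral {X..} ?g) ({0..X} \<union> {X..})"
    using 1 2 X by (intro has_integral_Un integrable_integral)
      (auto intro!: negligible_subset[of "{X}"])
  moreover have "{0..X} \<union> {X..} = {0..}"
    using X by auto
  ultimately have "(?g has_integral integral {0..X} ?g + integral {X..} ?g) {0..}"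
    by simp
  moreover from this have "integral {0..} ?g = 0"
    using mom by (auto simp: momentum_exists_def momentum_def integrable_on_def)
  ultimately have "integral {0..X} ?g = - integral {X..} ?g"
    by (simp add: has_integral_iff)
  with 2(2) show ?thesis
    by simp
qed

section \<open>Size of the pieces of the transform\<close>

lemma powr_le_two_power:
  fixes s x \<gamma> :: real
  assumes "0 < x" "x / 2 \<le> s" "s \<le> x" "- real N \<le> \<gamma>" "\<gamma> \<le> 0"
  shows "s powr \<gamma> \<le> 2 ^ N * x powr \<gamma>"
proof -
  have "s powr \<gamma> \<le> (x / 2) powr \<gamma>"
    using assms by (intro powr_mono2') auto
  also have "\<dots> = 2 powr (- \<gamma>) * x powr \<gamma>"
    using assms by (simp add: powr_divide powr_minus_divide)
  also have "2 powr (- \<gamma>) \<le> 2 powr real N"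
    using assms by (intro powr_mono) auto
  finally show ?thesis
    using assms by (simp add: powr_realpow mult_right_mono)
qed

text \<open>Here sin \<theta> \<ge> 1/2, so f is evaluated in [x/2, x], where it is of order
  x^(\<beta>-2m); the prefactor x^(2m+1) turns this into x^(\<beta>+1).\<close>

lemma F_op_outer_bound:
  assumes f: "power_dominated f (\<beta> - 2 * real m) C" and \<beta>: "- 3/2 \<le> \<beta>" "\<beta> \<le> - 1/2" and x: "2 \<le> x"
  shows "\<bar>x ^ (2*m+1) * integral {pi/6..pi/2} (\<lambda>\<theta>. f (x * sin \<theta>))\<bar>
          \<le> 2 ^ (2*m+3) * C * x powr (\<beta> + 1)"
proof -
  let ?\<gamma> = "\<beta> - 2 * real m"
  note fD = power_dominatedD[OF f]
  \<comment> \<open>The exponent is at least -(2m+2), so halving the argument costs at most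
    2^(2m+2). The interval length, below 2, later contributes one more factor 2.\<close>
  let ?B = "2 ^ (2*m+2) * C * x powr ?\<gamma>"
  have bnd: "\<bar>f (x * sin \<theta>)\<bar> \<le> ?B" if \<theta>: "\<theta> \<in> {pi/6..pi/2}" for \<theta>
  proof -
    have s: "1 / 2 \<le> sin \<theta>"
      using \<theta> sin_monotone_2pi_le[of "pi/6" \<theta>] by (auto simp: sin_30)
    have le: "x / 2 \<le> x * sin \<theta>" "x * sin \<theta> \<le> x"
      using s x mult_left_mono[OF s, of x] by (auto simp: mult_left_le)
    then have le1: "1 \<le> x * sin \<theta>"
      using x by linarith
    have "\<bar>f (x * sin \<theta>)\<bar> \<le> C * (x * sin \<theta>) powr ?\<gamma>"
      by (intro fD le1)
    also have "\<dots> \<le> C * (2 ^ (2*m+2) * x powr ?\<gamma>)"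
      using le x \<beta> by (intro mult_left_mono powr_le_two_power fD) auto
    finally show ?thesis by (simp add: mult_ac)
  qed
  have cont: "continuous_on {pi/6..pi/2} (\<lambda>\<theta>. f (x * sin \<theta>))"
    using x by (intro continuous_on_compose2[OF fD(1)] continuous_intros)
      (auto intro!: mult_nonneg_nonneg sin_ge_zero)
  have "norm (integral {pi/6..pi/2} (\<lambda>\<theta>. f (x * sin \<theta>))) \<le> ?B * (pi/2 - pi/6)"
    using bnd by (intro integral_bound cont) auto
  also have "\<dots> \<le> ?B * 2"
    using fD(4) pi_less_4 by (intro mult_left_mono mult_nonneg_nonneg) auto
  finally have "x ^ (2*m+1) * \<bar>integral {pi/6..pi/2} (\<lambda>\<theta>. f (x * sin \<theta>))\<bar> \<le> x ^ (2*m+1) * (?B * 2)"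
    using x by (intro mult_left_mono) auto
  also have "\<dots> = 2 ^ (2*m+3) * C * (x powr real (2*m+1) * x powr ?\<gamma>)"
    using x by (subst powr_realpow) (auto simp: power_add)
  also have "x powr real (2*m+1) * x powr ?\<gamma> = x powr (\<beta> + 1)"
    by (simp add: add.commute flip: powr_add)
  finally show ?thesis
    using x by (simp add: abs_mult)
qed

text \<open>This controls the Taylor remainder at s = x sin \<theta>. For s \<le> 1 boundedness of f
  suffices; for s > 1 the product s^(2m+2) \<bar>f s\<bar> is at most C s^(\<beta>+2), and \<beta> +
  2 > 0 makes s = x the worst case.\<close>

lemma power_dominated_rest_bound:
  assumes f: "power_dominated f (\<beta> - 2 * real m) C" and \<beta>: "- 3/2 \<le> \<beta>" "\<beta> \<le> - 1/2" and x: "2 \<le> x"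
    and s: "0 \<le> s" "s \<le> x"
  shows "x ^ (2*m+1) * (\<bar>f s\<bar> * (s / x) ^ (2*m+2)) \<le> C * (1 + x powr (\<beta> + 1))"
proof -
  note fD = power_dominatedD[OF f]
  have eq: "x ^ (2*m+1) * (\<bar>f s\<bar> * (s / x) ^ (2*m+2)) = s ^ (2*m+2) * \<bar>f s\<bar> / x"
    using x by (simp add: power_divide field_simps)
  show ?thesis
  proof (cases "s \<le> 1")
    case True
    have "s ^ (2*m+2) * \<bar>f s\<bar> / x \<le> 1 * C / 1"
      using s x True fD(4) by (intro frac_le mult_mono fD power_le_one) auto
    also have "\<dots> \<le> C * (1 + x powr (\<beta> + 1))"
      using fD(4) by (simp add: distrib_left)
    finally show ?thesis
      by (simp only: eq)
  next
    case False
    have "s ^ (2*m+2) * \<bar>f s\<bar> \<le> C * s powr (\<beta> - 2 * real m + real (2*m+2))"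
      using power_dominated_mult_power[OF f, of s "2*m+2"] False s by (simp add: abs_mult)
    also have "\<dots> = C * s powr (\<beta> + 2)"
      by (simp add: algebra_simps)
    also have "\<dots> \<le> C * x powr (\<beta> + 2)"
      using s \<beta> fD(4) by (intro mult_left_mono powr_mono2) auto
    also have "x powr (\<beta> + 2) = x powr (\<beta> + 1) * x"
      using x powr_add[of x "\<beta> + 1" 1] by (simp add: add.assoc)
    finally have "s ^ (2*m+2) * \<bar>f s\<bar> / x \<le> C * x powr (\<beta> + 1)"
      using x by (simp add: divide_le_eq mult.assoc)
    also have "\<dots> \<le> C * (1 + x powr (\<beta> + 1))"
      using fD(4) by (simp add: distrib_left)
    finally show ?thesis
      by (simp only: eq)
  qed
qed

text \<open>The vanishing moment makes the integral a tail of order x^(\<beta>+1-2(m-k)), which the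
  remaining prefactor x^(2(m-k)) raises to x^(\<beta>+1). A nonzero moment would leave a term of
  order x^(2(m-k)).\<close>

lemma power_dominated_inner_moment:
  assumes f: "power_dominated f (\<beta> - 2 * real m) C" and \<beta>: "- 3/2 \<le> \<beta>" "\<beta> \<le> - 1/2" and x: "2 \<le> x"
    and k: "k < m" and mom: "momentum_exists (Suc k) f \<Longrightarrow> momentum (Suc k) f = 0"
  shows "\<bar>x ^ (2*m+1) * (integral {0..x/2} (\<lambda>s. s ^ (2*k) * f s) / x ^ Suc (2*k))\<bar>
          \<le> 2 ^ (2*m+2) * C * x powr (\<beta> + 1)"
proof -
  let ?A = "integral {0..x/2} (\<lambda>s. s ^ (2*k) * f s)"
  let ?e = "\<beta> - 2 * real m + 2 * real k + 1"
  have km: "real k + 1 \<le> real m"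
    using k by linarith
  have "\<bar>?A\<bar> \<le> C * (x/2) powr ?e"
    using \<beta> x km by (intro power_dominated_partial_moment[OF f _ _ mom]) auto
  also have "\<dots> \<le> C * (2 ^ (2*m+2) * x powr ?e)"
    using \<beta> x km by (intro mult_left_mono powr_le_two_power power_dominatedD(4)[OF f])
      auto
  finally have "x ^ (2*(m-k)) * \<bar>?A\<bar> \<le> x ^ (2*(m-k)) * (C * (2 ^ (2*m+2) * x powr ?e))"
    using x by (intro mult_left_mono) auto
  also have "\<dots> = 2 ^ (2*m+2) * C * (x powr real (2*(m-k)) * x powr ?e)"
    using x by (subst powr_realpow) auto
  also have "x powr real (2*(m-k)) * x powr ?e = x powr (\<beta> + 1)"
    using k by (simp add: of_nat_diff algebra_simps flip: powr_add)
  also have "x ^ (2*(m-k)) * \<bar>?A\<bar> = \<bar>x ^ (2*m+1) * (?A / x ^ Suc (2*k))\<bar>"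
  proof -
    have "2*m+1 = 2*(m-k) + Suc (2*k)"
      using k by simp
    then have "x ^ (2*m+1) = x ^ (2*(m-k)) * x ^ Suc (2*k)"
      by (simp only: power_add)
    then show ?thesis
      using x by (simp add: abs_mult)
  qed
  finally show ?thesis .
qed

text \<open>For k = m the integrand is of order s^\<beta> with \<beta> near -1, so no tail is taken
  and only the limit x/2 is moved to x. The integrand is O(x^\<beta>) on an interval of length
  x/2.\<close>

lemma power_dominated_outer_moment:
  assumes f: "power_dominated f (\<beta> - 2 * real m) C" and \<beta>: "- 3/2 \<le> \<beta>" "\<beta> \<le> - 1/2" and x: "2 \<le> x"
  shows "\<bar>integral {0..x/2} (\<lambda>s. s ^ (2*m) * f s) - integral {0..x} (\<lambda>s. s ^ (2*m) * f s)\<bar>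
           \<le> 4 * C * x powr (\<beta> + 1)"
proof -
  let ?g = "\<lambda>s. s ^ (2*m) * f s"
  note fD = power_dominatedD[OF f]
  have "integral {0..x/2} ?g + integral {x/2..x} ?g = integral {0..x} ?g"
    using x by (intro Henstock_Kurzweil_Integration.integral_combine
        integrable_continuous_interval continuous_on_mult_power fD) auto
  moreover have "norm (integral {x/2..x} ?g) \<le> (C * (4 * x powr \<beta>)) * (x - x/2)"
  proof (rule integral_bound)
    show "x/2 \<le> x" "continuous_on {x/2..x} ?g"
      using x by (auto intro!: continuous_on_mult_power fD)
    show "norm (?g s) \<le> C * (4 * x powr \<beta>)" if s: "s \<in> {x/2..x}" for s
    proof -
      have "\<bar>?g s\<bar> \<le> C * s powr (\<beta> - 2 * real m + real (2*m))"
        using s x by (intro power_dominated_mult_power[OF f]) auto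
      also have "\<dots> \<le> C * (2 ^ 2 * x powr (\<beta> - 2 * real m + real (2*m)))"
        using s x \<beta> by (intro mult_left_mono powr_le_two_power fD) auto
      finally show "norm (?g s) \<le> C * (4 * x powr \<beta>)"
        by simp
    qed
  qed
  moreover have "(C * (4 * x powr \<beta>)) * (x - x/2) = 2 * (C * x powr (\<beta> + 1))"
    using x by (simp add: powr_add)
  moreover have "0 \<le> C * x powr (\<beta> + 1)"
    using fD(4) by simp
  ultimately show ?thesis
    unfolding real_norm_def by linarith
qed

text \<open>The expansion of 1 is multiplied by f(x sin \<theta>) and integrated: each summand
  becomes a truncated moment, and the remainder is bounded pointwise on an interval of length pi/6 <
  1.\<close>

lemma F_op_inner_expansion:
  assumes f: "power_dominated f (\<beta> - 2 * real m) C" and \<beta>: "- 3/2 \<le> \<beta>" "\<beta> \<le> - 1/2" and x: "2 \<le> x"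
    and K: "0 \<le> K" "\<And>\<theta>. 0 \<le> \<theta> \<Longrightarrow> \<theta> \<le> pi/6 \<Longrightarrow>
       \<bar>1 - (\<Sum>k\<le>m. inv_sqrt_coeff k * (sin \<theta> ^ (2*k) * cos \<theta>))\<bar> \<le> K * sin \<theta> ^ (2*m+2)"
  shows "\<bar>x ^ (2*m+1) * (integral {0..pi/6} (\<lambda>\<theta>. f (x * sin \<theta>))
           - (\<Sum>k\<le>m. inv_sqrt_coeff k * (integral {0..x/2} (\<lambda>s. s ^ (2*k) * f s) / x ^ Suc (2*k))))\<bar>
         \<le> K * C * (1 + x powr (\<beta> + 1))"
proof -
  note fD = power_dominatedD[OF f]
  let ?r = "\<lambda>\<theta>. 1 - (\<Sum>k\<le>m. inv_sqrt_coeff k * (sin \<theta> ^ (2*k) * cos \<theta>))"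
  let ?S = "\<Sum>k\<le>m. inv_sqrt_coeff k * (integral {0..x/2} (\<lambda>s. s ^ (2*k) * f s) / x ^ Suc (2*k))"
  have cont: "continuous_on {0..pi/6} (\<lambda>\<theta>. f (x * sin \<theta>))"
    using x by (intro continuous_on_compose2[OF fD(1)] continuous_intros)
      (auto intro!: mult_nonneg_nonneg sin_ge_zero)
  have "((\<lambda>\<theta>. f (x * sin \<theta>) - (\<Sum>k\<le>m. inv_sqrt_coeff k * (f (x * sin \<theta>) * (sin \<theta> ^ (2*k) * cos \<theta>))))
          has_integral (integral {0..pi/6} (\<lambda>\<theta>. f (x * sin \<theta>)) - ?S)) {0..pi/6}"
    using x by (intro has_integral_diff has_integral_sum has_integral_mult_right
        integral_sin_substitution fD integrable_integral integrable_continuous_interval cont) auto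
  then have I: "((\<lambda>\<theta>. x ^ (2*m+1) * (f (x * sin \<theta>) * ?r \<theta>))
          has_integral x ^ (2*m+1) * (integral {0..pi/6} (\<lambda>\<theta>. f (x * sin \<theta>)) - ?S)) {0..pi/6}"
    by (intro has_integral_mult_right) (simp add: right_diff_distrib sum_distrib_left mult_ac)
  have bnd: "norm (x ^ (2*m+1) * (f (x * sin \<theta>) * ?r \<theta>)) \<le> K * (C * (1 + x powr (\<beta> + 1)))"
    if \<theta>: "\<theta> \<in> {0..pi/6}" for \<theta>
  proof -
    have s: "0 \<le> sin \<theta>"
      using \<theta> by (intro sin_ge_zero) auto
    have "norm (x ^ (2*m+1) * (f (x * sin \<theta>) * ?r \<theta>))
        = x ^ (2*m+1) * (\<bar>f (x * sin \<theta>)\<bar> * \<bar>?r \<theta>\<bar>)"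
      using x by (simp add: abs_mult)
    also have "\<dots> \<le> x ^ (2*m+1) * (\<bar>f (x * sin \<theta>)\<bar> * (K * sin \<theta> ^ (2*m+2)))"
      using x \<theta> by (intro mult_left_mono K) auto
    also have "\<dots> = K * (x ^ (2*m+1) * (\<bar>f (x * sin \<theta>)\<bar> * (x * sin \<theta> / x) ^ (2*m+2)))"
      using x by simp
    also have "\<dots> \<le> K * (C * (1 + x powr (\<beta> + 1)))"
      using x s by (intro mult_left_mono power_dominated_rest_bound[OF f \<beta>] K) (auto simp: mult_left_le)
    finally show ?thesis .
  qed
  have "norm (x ^ (2*m+1) * (integral {0..pi/6} (\<lambda>\<theta>. f (x * sin \<theta>)) - ?S))
     \<le> K * (C * (1 + x powr (\<beta> + 1))) * measure lborel (cbox 0 (pi/6))"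
    using I bnd K fD(4) by (intro has_integral_bound) (auto intro!: mult_nonneg_nonneg add_nonneg_nonneg)
  also have "\<dots> \<le> K * (C * (1 + x powr (\<beta> + 1))) * 1"
    using K fD(4) pi_less_4 by (intro mult_left_mono) (auto intro!: mult_nonneg_nonneg add_nonneg_nonneg)
  finally show ?thesis
    by (simp add: mult_ac)
qed

text \<open>K is fixed before f, \<beta>, C and x; this order of quantifiers is the uniformity in
  the parameter.\<close>

proposition F_op_approx_moment:
  obtains K where "0 \<le> K"
    "\<And>f \<beta> C x. power_dominated f (\<beta> - 2 * real m) C \<Longrightarrow> - 3/2 \<le> \<beta> \<Longrightarrow> \<beta> \<le> - 1/2 \<Longrightarrow> 2 \<le> x \<Longrightarrow>
       (\<And>n. n \<in> {1..m} \<Longrightarrow> momentum_exists n f \<Longrightarrow> momentum n f = 0) \<Longrightarrow>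
       \<bar>x ^ (2*m+1) * F_op f x - inv_sqrt_coeff m * integral {0..x} (\<lambda>s. s ^ (2*m) * f s)\<bar>
         \<le> K * C * (1 + x powr (\<beta> + 1))"
proof -
  obtain K where K: "0 \<le> K" "\<And>\<theta>. 0 \<le> \<theta> \<Longrightarrow> \<theta> \<le> pi/6 \<Longrightarrow>
       \<bar>1 - (\<Sum>k\<le>m. inv_sqrt_coeff k * (sin \<theta> ^ (2*k) * cos \<theta>))\<bar> \<le> K * sin \<theta> ^ (2*m+2)"
    using one_minus_cos_sin_sum_bound[of m] by blast
  \<comment> \<open>In order: the outer piece, the moments with k < m, moving x/2 to x for k = m,
    and the Taylor remainder.\<close>
  let ?L = "2 ^ (2*m+3) + (\<Sum>k<m. inv_sqrt_coeff k * 2 ^ (2*m+2)) + inv_sqrt_coeff m * 4 + K"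
  show thesis
  proof
    show "0 \<le> ?L"
      using K by (intro add_nonneg_nonneg sum_nonneg mult_nonneg_nonneg inv_sqrt_coeff_nonneg) auto
  next
    fix f \<beta> C and x :: real
    assume f: "power_dominated f (\<beta> - 2 * real m) C" and \<beta>: "- 3/2 \<le> \<beta>" "\<beta> \<le> - 1/2" and x: "2 \<le> x"
      and mom: "\<And>n. n \<in> {1..m} \<Longrightarrow> momentum_exists n f \<Longrightarrow> momentum n f = 0"
    note fD = power_dominatedD[OF f]
    let ?P = "x ^ (2*m+1)"
    define A where "A k = integral {0..x/2} (\<lambda>s. s ^ (2*k) * f s)" for k
    define B where "B = integral {0..x} (\<lambda>s. s ^ (2*m) * f s)"
    define I1 where "I1 = integral {0..pi/6} (\<lambda>\<theta>. f (x * sin \<theta>))"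
    define I2 where "I2 = integral {pi/6..pi/2} (\<lambda>\<theta>. f (x * sin \<theta>))"
    define T where "T = C * (1 + x powr (\<beta> + 1))"
    have T: "C * x powr (\<beta> + 1) \<le> T"
      using fD(4) by (simp add: T_def distrib_left)
    have F: "F_op f x = I1 + I2"
      unfolding F_op_def I1_def I2_def using x
      by (intro Henstock_Kurzweil_Integration.integral_combine[symmetric] integrable_continuous_interval
          continuous_on_compose2[OF fD(1)] continuous_intros)
        (auto intro!: mult_nonneg_nonneg sin_ge_zero)
    have 1: "\<bar>?P * I2\<bar> \<le> 2 ^ (2*m+3) * T"
      using F_op_outer_bound[OF f \<beta> x] mult_left_mono[OF T zero_le_power, of 2 "2*m+3"]
      unfolding I2_def mult.assoc by linarith
    have 2: "\<bar>?P * (I1 - (\<Sum>k\<le>m. inv_sqrt_coeff k * (A k / x ^ Suc (2*k))))\<bar> \<le> K * T"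
      using F_op_inner_expansion[OF f \<beta> x K] by (simp add: I1_def A_def T_def mult.assoc)
    have 3: "\<bar>\<Sum>k<m. inv_sqrt_coeff k * (?P * (A k / x ^ Suc (2*k)))\<bar>
               \<le> (\<Sum>k<m. inv_sqrt_coeff k * (2 ^ (2*m+2) * T))"
    proof (intro order.trans[OF sum_abs] sum_mono)
      fix k assume "k \<in> {..<m}"
      then have k: "k < m" "Suc k \<in> {1..m}"
        by auto
      have "\<bar>?P * (A k / x ^ Suc (2*k))\<bar> \<le> 2 ^ (2*m+2) * T"
        using power_dominated_inner_moment[OF f \<beta> x k(1) mom[OF k(2)]]
          mult_left_mono[OF T zero_le_power, of 2 "2*m+2"]
        unfolding A_def mult.assoc by linarith
      then show "\<bar>inv_sqrt_coeff k * (?P * (A k / x ^ Suc (2*k)))\<bar> \<le> inv_sqrt_coeff k * (2 ^ (2*m+2) * T)"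
        unfolding abs_mult[of "inv_sqrt_coeff k"] abs_of_nonneg[OF inv_sqrt_coeff_nonneg]
        by (intro mult_left_mono inv_sqrt_coeff_nonneg)
    qed
    have "\<bar>A m - B\<bar> \<le> 4 * T"
      using power_dominated_outer_moment[OF f \<beta> x] T by (simp add: A_def B_def)
    then have 4: "\<bar>inv_sqrt_coeff m * (A m - B)\<bar> \<le> inv_sqrt_coeff m * (4 * T)"
      by (simp add: abs_mult inv_sqrt_coeff_nonneg mult_left_mono)
    have Pm: "?P * (A m / x ^ Suc (2*m)) = A m"
      using x by simp
    have "?P * (\<Sum>k\<le>m. inv_sqrt_coeff k * (A k / x ^ Suc (2*k)))
        = (\<Sum>k\<le>m. inv_sqrt_coeff k * (?P * (A k / x ^ Suc (2*k))))"
      unfolding sum_distrib_left by (intro sum.cong refl mult.left_commute)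
    also have "\<dots> = (\<Sum>k<m. inv_sqrt_coeff k * (?P * (A k / x ^ Suc (2*k)))) + inv_sqrt_coeff m * A m"
      unfolding lessThan_Suc_atMost[symmetric] sum.lessThan_Suc Pm ..
    \<comment> \<open>An exact splitting into the four quantities estimated in \<open>1\<close> to
      \<open>4\<close>.\<close>
    finally have "?P * F_op f x - inv_sqrt_coeff m * B
        = ?P * I2 + ?P * (I1 - (\<Sum>k\<le>m. inv_sqrt_coeff k * (A k / x ^ Suc (2*k))))
          + (\<Sum>k<m. inv_sqrt_coeff k * (?P * (A k / x ^ Suc (2*k)))) + inv_sqrt_coeff m * (A m - B)"
      by (simp add: F algebra_simps)
    also have "\<bar>\<dots>\<bar> \<le> 2 ^ (2*m+3) * T + K * T + (\<Sum>k<m. inv_sqrt_coeff k * (2 ^ (2*m+2) * T))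
        + inv_sqrt_coeff m * (4 * T)"
      using 1 2 3 4 by linarith
    also have "\<dots> = ?L * T"
      by (simp only: distrib_right sum_distrib_right mult.assoc)
    finally show "\<bar>?P * F_op f x - inv_sqrt_coeff m * integral {0..x} (\<lambda>s. s ^ (2*m) * f s)\<bar>
       \<le> ?L * C * (1 + x powr (\<beta> + 1))"
      by (simp add: B_def T_def mult.assoc)
  qed
qed

subsection \<open>The compensator\<close>

lemma has_integral_powr_compensator:
  assumes "0 < X" "X \<le> x"
  shows "((\<lambda>s. s powr \<beta>) has_integral compensator x \<beta> - compensator X \<beta>) {X..x}"
proof (rule fundamental_theorem_of_calculus[OF assms(2)])
  fix s assume s: "s \<in> {X..x}"
  show "((\<lambda>x. compensator x \<beta>) has_vector_derivative s powr \<beta>) (at s within {X..x})"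
  proof (cases "\<beta> = -1")
    case True
    then show ?thesis
      using s assms unfolding has_real_derivative_iff_has_vector_derivative[symmetric] compensator_def
      by (auto intro!: derivative_eq_intros simp: powr_minus divide_inverse)
  next
    case False
    then have "\<beta> + 1 \<noteq> 0"
      by linarith
    with False show ?thesis
      using s assms unfolding has_real_derivative_iff_has_vector_derivative[symmetric] compensator_def
      by (auto intro!: derivative_eq_intros)
  qed
qed

lemma compensator_1 [simp]: "compensator 1 \<beta> = 0"
  by (simp add: compensator_def)

text \<open>For \<beta> \<le> 0 the integrand s^\<beta> lies between 0 and 1 on [1,X]; the bound is
  uniform in \<beta>, as needed at a fixed cut X.\<close>

lemma compensator_bounds:
  assumes "1 \<le> X" "\<beta> \<le> 0"
  shows "0 \<le> compensator X \<beta>" "compensator X \<beta> \<le> X"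
proof -
  have I: "((\<lambda>s. s powr \<beta>) has_integral compensator X \<beta>) {1..X}"
    using has_integral_powr_compensator[of 1 X \<beta>] assms by simp
  show "0 \<le> compensator X \<beta>"
    by (rule has_integral_nonneg[OF I]) auto
  have "((\<lambda>s. 1) has_integral X - 1) {1..X}"
    using has_integral_const_real[of "1::real" 1 X] assms by simp
  then have "compensator X \<beta> \<le> X - 1"
    using assms(2) by (intro has_integral_le[OF I]) (auto intro: order.trans[OF powr_mono[of \<beta> 0]])
  then show "compensator X \<beta> \<le> X"
    by simp
qed

text \<open>With t = \<beta> + 1 and L = ln x the compensator is (exp(tL) - 1)/t for t \<noteq> 0.
  If t > 0, exp u \<ge> 1 + u gives at least L. If t < 0 and y = -tL, it gives 1 - exp(-y) \<ge>
  y/(1+y), and division by -t yields the bound.\<close>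

lemma compensator_lower_bound:
  assumes "1 < x"
  shows "ln x / (1 + \<bar>\<beta> + 1\<bar> * ln x) \<le> compensator x \<beta>"
proof -
  define t where "t = \<beta> + 1"
  define L where "L = ln x"
  have L: "0 < L" and xp: "x powr t = exp (t * L)"
    using assms by (auto simp: L_def powr_def)
  consider "t = 0" | "0 < t" | "t < 0"
    by linarith
  then have "L / (1 + \<bar>t\<bar> * L) \<le> compensator x \<beta>"
  proof cases
    case 1
    then have "\<beta> = -1" by (simp add: t_def)
    then show ?thesis using 1 by (simp add: compensator_def L_def)
  next
    case 2
    have "t * L \<le> exp (t * L) - 1"
      using exp_ge_add_one_self[of "t * L"] by linarith
    have "L / (1 + \<bar>t\<bar> * L) \<le> L / 1"
      using 2 L by (intro divide_left_mono) (auto intro: add_pos_nonneg)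
    also have "\<dots> \<le> (exp (t * L) - 1) / t"
      using 2 \<open>t * L \<le> exp (t * L) - 1\<close> by (simp add: le_divide_eq mult.commute)
    finally show ?thesis
      using 2 xp by (auto simp: compensator_def t_def)
  next
    case 3
    define y where "y = - (t * L)"
    have y: "0 < y"
      using 3 L by (simp add: y_def mult_neg_pos)
    have "1 / exp y \<le> 1 / (1 + y)"
      using y exp_ge_add_one_self[of y] by (intro divide_left_mono) auto
    then have "y / (1 + y) \<le> 1 - exp (- y)"
      using y by (simp add: exp_minus field_simps)
    then have "y / (1 + y) / - t \<le> (1 - exp (- y)) / - t"
      using 3 by (intro divide_right_mono) auto
    moreover have "y / (1 + y) / - t = L / (1 + \<bar>t\<bar> * L)"
      using 3 by (simp add: y_def)
    moreover have "(1 - exp (- y)) / - t = (exp (t * L) - 1) / t"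
      by (simp add: y_def minus_divide_left)
    ultimately show ?thesis
      using 3 xp by (auto simp: compensator_def t_def)
  qed
  then show ?thesis
    by (simp add: t_def L_def)
qed

text \<open>Inverting the lower bound separates x from \<beta>, so the reciprocal tends to 0 in the
  joint limit whatever the relative rates.\<close>

lemma inverse_compensator_bound:
  assumes "1 < x"
  shows "0 < compensator x \<beta>" "1 / compensator x \<beta> \<le> 1 / ln x + \<bar>\<beta> + 1\<bar>"
proof -
  have L: "0 < ln x"
    using assms by simp
  have D: "0 < 1 + \<bar>\<beta> + 1\<bar> * ln x"
    using L by (simp add: add_pos_nonneg)
  have pos: "0 < ln x / (1 + \<bar>\<beta> + 1\<bar> * ln x)"
    using L D by (intro divide_pos_pos)
  then show "0 < compensator x \<beta>"
    using compensator_lower_bound[OF assms, of \<beta>] by linarith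
  then have "1 / compensator x \<beta> \<le> 1 / (ln x / (1 + \<bar>\<beta> + 1\<bar> * ln x))"
    using compensator_lower_bound[OF assms, of \<beta>] pos by (intro divide_left_mono mult_pos_pos) auto
  also have "\<dots> = 1 / ln x + \<bar>\<beta> + 1\<bar>"
    using L by (simp add: add_divide_distrib)
  finally show "1 / compensator x \<beta> \<le> 1 / ln x + \<bar>\<beta> + 1\<bar>" .
qed

text \<open>The reflection replaces t = \<beta> + 1 by -t, and x^t (x^(-t) - 1)/(-t) = (x^t -
  1)/t.\<close>

lemma compensator_reflect:
  assumes "0 < x"
  shows "compensator x (- \<beta> - 2) * x powr (\<beta> + 1) = compensator x \<beta>"
proof (cases "\<beta> = -1")
  case False
  then have "\<beta> + 1 \<noteq> 0" "- \<beta> - 2 + 1 \<noteq> 0" "- \<beta> - 2 \<noteq> - 1"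
    by linarith+
  moreover have "x powr (- \<beta> - 2 + 1) * x powr (\<beta> + 1) = 1"
    using assms by (simp flip: powr_add)
  ultimately show ?thesis
    using False unfolding compensator_def by (simp add: field_simps)
qed (use assms in \<open>simp add: compensator_def\<close>)

text \<open>Reflection turns x^(\<beta>+1) over the compensator into a reciprocal compensator at
  -\<beta> - 2, and the reciprocal bound only sees \<bar>\<beta> + 1\<bar>.\<close>

lemma powr_over_compensator_bound:
  assumes "1 < x"
  shows "(1 + x powr (\<beta> + 1)) / compensator x \<beta> \<le> 2 * (1 / ln x + \<bar>\<beta> + 1\<bar>)"
proof -
  have "x powr (\<beta> + 1) / compensator x \<beta> = 1 / compensator x (- \<beta> - 2)"
    using assms by (subst compensator_reflect[symmetric]) auto
  also have "\<dots> \<le> 1 / ln x + \<bar>- \<beta> - 2 + 1\<bar>"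
    using assms by (rule inverse_compensator_bound)
  also have "\<bar>- \<beta> - 2 + 1\<bar> = \<bar>\<beta> + 1\<bar>"
    by linarith
  finally show ?thesis
    using inverse_compensator_bound(2)[OF assms, of \<beta>] by (simp add: add_divide_distrib)
qed

text \<open>The recurrence Gamma(z+1) = z Gamma(z) at z = (1+\<beta>)/2 absorbs the factor \<beta> +
  1 together with the pole. What remains is \<open>h\<close>, continuous at -1 with value sqrt(pi)
  Gamma(1) / Gamma(1/2) = 1.\<close>

lemma tendsto_Omega_factor:
  "((\<lambda>\<beta>. if \<beta> = -1 then 1 else (\<beta> + 1) * G_fun \<beta>) \<longlongrightarrow> 1) (nhds (-1))"
proof -
  define h where "h \<beta> = sqrt pi * (Gamma ((3 + \<beta>) / 2) / Gamma (1 + \<beta> / 2))" for \<beta> :: real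
  have "isCont h (-1)"
    unfolding h_def by (intro continuous_intros) (auto simp: Gamma_one_half_real elim!: nonpos_Ints_cases)
  moreover have "h (-1) = 1"
    by (simp add: h_def Gamma_one_half_real)
  ultimately have "(h \<longlongrightarrow> 1) (nhds (-1))"
    using tendsto_at_iff_tendsto_nhds[of h "-1"] by (simp add: isCont_def)
  moreover have "\<forall>\<^sub>F \<beta> in nhds (-1). h \<beta> = (if \<beta> = -1 then 1 else (\<beta> + 1) * G_fun \<beta>)"
  proof -
    \<comment> \<open>On this interval (1+\<beta>)/2 > -1/2, so the only pole of Gamma in reach is
      0, that is \<beta> = -1.\<close>
    have "\<forall>\<^sub>F \<beta> in nhds (-1). \<beta> \<in> {-2<..<0::real}"
      by (intro eventually_nhds_in_open) auto
    then show ?thesis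
    proof eventually_elim
      case (elim \<beta>)
      show ?case
      proof (cases "\<beta> = -1")
        case False
        have "(1 + \<beta>) / 2 \<notin> \<int>\<^sub>\<le>\<^sub>0"
        proof
          assume "(1 + \<beta>) / 2 \<in> \<int>\<^sub>\<le>\<^sub>0"
          then obtain n where "(1 + \<beta>) / 2 = of_int n" "n \<le> 0"
            by (elim nonpos_Ints_cases)
          moreover from this elim have "real_of_int (-1) < real_of_int n"
            by simp
          then have "-1 < n"
            by (simp only: of_int_less_iff)
          ultimately show False
            using False by simp
        qed
        then have "Gamma ((1 + \<beta>) / 2 + 1) = (1 + \<beta>) / 2 * Gamma ((1 + \<beta>) / 2)"
          by (rule Gamma_plus1)
        moreover have "(1 + \<beta>) / 2 + 1 = (3 + \<beta>) / 2"
          by simp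
        ultimately have "Gamma ((3 + \<beta>) / 2) = (1 + \<beta>) / 2 * Gamma ((1 + \<beta>) / 2)"
          by (simp only:)
        then have "h \<beta> = (\<beta> + 1) * G_fun \<beta>"
          unfolding h_def G_fun_def by (simp only:) (simp add: add.commute)
        with False show ?thesis
          by simp
      qed (simp add: \<open>h (-1) = 1\<close>)
    qed
  qed
  ultimately show ?thesis
    by (rule Lim_transform_eventually)
qed

subsection \<open>Uniform asymptotics in the parameter\<close>

text \<open>The integral is cut at X. What does not grow with x, namely the integral over [0,X] and
  a times the compensator at X, is collected in (B + \<bar>a\<bar>) X.\<close>

lemma integral_compensator_approx:
  fixes g :: "real \<Rightarrow> real"
  assumes cont: "continuous_on {0..} g" and X: "1 \<le> X" "X \<le> x" and \<beta>: "\<beta> \<le> 0" and \<epsilon>: "0 \<le> \<epsilon>"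
    and B: "\<And>s. s \<in> {0..X} \<Longrightarrow> \<bar>g s\<bar> \<le> B"
    and g: "\<And>s. X \<le> s \<Longrightarrow> \<bar>g s - a * s powr \<beta>\<bar> \<le> \<epsilon> * s powr \<beta>"
  shows "\<bar>integral {0..x} g - a * compensator x \<beta>\<bar> \<le> \<epsilon> * compensator x \<beta> + (B + \<bar>a\<bar>) * X"
proof -
  have int: "g integrable_on {u..v}" if "0 \<le> u" for u v
    using that by (intro integrable_continuous_interval continuous_on_subset[OF cont]) auto
  have split: "integral {0..X} g + integral {X..x} g = integral {0..x} g"
    using X by (intro Henstock_Kurzweil_Integration.integral_combine int) auto
  have I: "((\<lambda>s. s powr \<beta>) has_integral compensator x \<beta> - compensator X \<beta>) {X..x}"
    using X by (intro has_integral_powr_compensator) auto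
  have D: "((\<lambda>s. g s - a * s powr \<beta>) has_integral
      integral {X..x} g - a * (compensator x \<beta> - compensator X \<beta>)) {X..x}"
    using X by (intro has_integral_diff has_integral_mult_right I integrable_integral int) auto
  have "norm (integral {X..x} (\<lambda>s. g s - a * s powr \<beta>)) \<le> integral {X..x} (\<lambda>s. \<epsilon> * s powr \<beta>)"
    using D I g by (intro integral_norm_bound_integral)
      (auto intro: has_integral_integrable integrable_on_mult_right)
  also have "integral {X..x} (\<lambda>s. \<epsilon> * s powr \<beta>) = \<epsilon> * (compensator x \<beta> - compensator X \<beta>)"
    by (intro integral_unique has_integral_mult_right I)
  also have "\<dots> \<le> \<epsilon> * compensator x \<beta>"
    using \<epsilon> compensator_bounds(1)[OF X(1) \<beta>] by (intro mult_left_mono) auto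
  finally have 1: "\<bar>integral {X..x} g - a * (compensator x \<beta> - compensator X \<beta>)\<bar> \<le> \<epsilon> * compensator x \<beta>"
    using integral_unique[OF D] by simp
  have "norm (integral {0..X} g) \<le> B * (X - 0)"
    using X B by (intro integral_bound continuous_on_subset[OF cont]) auto
  then have 2: "\<bar>integral {0..X} g\<bar> \<le> B * X"
    by simp
  have 3: "\<bar>a * compensator X \<beta>\<bar> \<le> \<bar>a\<bar> * X"
    using compensator_bounds[OF X(1) \<beta>] by (simp add: abs_mult mult_left_mono)
  have "integral {0..x} g - a * compensator x \<beta> = integral {0..X} g
      + (integral {X..x} g - a * (compensator x \<beta> - compensator X \<beta>)) - a * compensator X \<beta>"
    by (simp add: split[symmetric] algebra_simps)
  with 1 2 3 show ?thesis
    by (simp add: distrib_right)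
qed

section \<open>Uniform estimates near the base parameter\<close>

lemma eventually_at_top_prod_nhdsE:
  assumes "\<forall>\<^sub>F (x::real, \<mu>) in at_top \<times>\<^sub>F F. P x \<mu>"
  obtains X where "c \<le> X" "\<forall>\<^sub>F \<mu> in F. \<forall>x\<ge>X. P x \<mu>"
proof -
  \<comment> \<open>The product filter supplies a rectangle, hence one threshold for all nearby
    parameters.\<close>
  obtain Q R where Q: "eventually Q at_top" and R: "eventually R F"
    and P: "\<And>x \<mu>. Q x \<Longrightarrow> R \<mu> \<Longrightarrow> P x \<mu>"
    using assms by (auto simp: eventually_prod_filter)
  obtain X where "\<And>x. X \<le> x \<Longrightarrow> Q x"
    using Q by (auto simp: eventually_at_top_linorder)
  then show thesis
    using R P by (intro that[of "max c X"]) (auto elim!: eventually_mono)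
qed

text \<open>
  For one large fixed \<open>x\<close>, both \<open>x powr \<alpha> \<mu>\<close> and \<open>x powr \<alpha> \<mu>0\<close> equal \<open>f\<close> up to a bounded factor, so
  \<open>\<bar>\<alpha> \<mu> - \<alpha> \<mu>0\<bar> * ln x\<close> is bounded independently of \<open>x\<close>.
\<close>

lemma exponent_tendsto:
  fixes f :: "'p::topological_space \<Rightarrow> real \<Rightarrow> real"
  assumes lim: "((\<lambda>(x, \<mu>). f \<mu> x * x powr (- \<alpha> \<mu>)) \<longlongrightarrow> a) (at_top \<times>\<^sub>F nhds \<mu>0)" and a: "a \<noteq> 0"
    and cont: "\<And>x. 0 \<le> x \<Longrightarrow> ((\<lambda>\<mu>. f \<mu> x) \<longlongrightarrow> f \<mu>0 x) (nhds \<mu>0)"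
  shows "(\<alpha> \<longlongrightarrow> \<alpha> \<mu>0) (nhds \<mu>0)"
proof (rule tendstoI)
  fix \<delta> :: real assume \<delta>: "0 < \<delta>"
  have "\<forall>\<^sub>F (x, \<mu>) in at_top \<times>\<^sub>F nhds \<mu>0. \<bar>f \<mu> x * x powr (- \<alpha> \<mu>) - a\<bar> < \<bar>a\<bar> / 2"
    using tendstoD[OF lim, of "\<bar>a\<bar> / 2"] a by (simp add: dist_real_def case_prod_unfold)
  then obtain X where X: "2 \<le> X"
    and ev: "\<forall>\<^sub>F \<mu> in nhds \<mu>0. \<forall>x\<ge>X. \<bar>f \<mu> x * x powr (- \<alpha> \<mu>) - a\<bar> < \<bar>a\<bar> / 2"
    by (rule eventually_at_top_prod_nhdsE[where c = 2])
  \<comment> \<open>This makes ln 6 < \<delta> ln x. The number 6 is 2 * 2 * 3/2: the constants 2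
    and 3/2 of \<open>powr_bounds\<close>, and the factor 2 by which \<bar>f \<mu> x\<bar> may
    differ from b.\<close>
  define x where "x = max X (exp (ln 6 / \<delta>) + 1)"
  have x: "X \<le> x" "2 \<le> x" "exp (ln 6 / \<delta>) < x"
    using X by (auto simp: x_def)
  have "ln 6 / \<delta> < ln x"
    using x ln_less_cancel_iff[of "exp (ln 6 / \<delta>)" x] by simp
  then have ln6: "ln 6 < \<delta> * ln x"
    using \<delta> by (simp add: divide_less_eq mult.commute)
  have eval: "\<bar>f \<mu> x\<bar> = \<bar>f \<mu> x * x powr (- \<alpha> \<mu>)\<bar> * x powr \<alpha> \<mu>" for \<mu>
    using x by (simp add: abs_mult powr_minus)
  define b where "b = \<bar>f \<mu>0 x\<bar>"
  have r0: "\<bar>f \<mu>0 x * x powr (- \<alpha> \<mu>0) - a\<bar> < \<bar>a\<bar> / 2"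
    using eventually_nhds_x_imp_x[OF ev] x by blast
  have powr_bounds: "2 / 3 * \<bar>f \<mu> x\<bar> \<le> \<bar>a\<bar> * x powr \<alpha> \<mu>" "\<bar>a\<bar> * x powr \<alpha> \<mu> \<le> 2 * \<bar>f \<mu> x\<bar>"
    if "\<bar>f \<mu> x * x powr (- \<alpha> \<mu>) - a\<bar> < \<bar>a\<bar> / 2" for \<mu>
  proof -
    have "\<bar>a\<bar> / 2 \<le> \<bar>f \<mu> x * x powr (- \<alpha> \<mu>)\<bar>" "\<bar>f \<mu> x * x powr (- \<alpha> \<mu>)\<bar> \<le> 3 / 2 * \<bar>a\<bar>"
      using that by linarith+
    then have "\<bar>a\<bar> / 2 * x powr \<alpha> \<mu> \<le> \<bar>f \<mu> x\<bar>" "\<bar>f \<mu> x\<bar> \<le> 3 / 2 * \<bar>a\<bar> * x powr \<alpha> \<mu>"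
      unfolding eval[of \<mu>] by (intro mult_right_mono; simp)+
    then show "2 / 3 * \<bar>f \<mu> x\<bar> \<le> \<bar>a\<bar> * x powr \<alpha> \<mu>" "\<bar>a\<bar> * x powr \<alpha> \<mu> \<le> 2 * \<bar>f \<mu> x\<bar>"
      by linarith+
  qed
  have "0 < \<bar>a\<bar> * x powr \<alpha> \<mu>0"
    using a x by simp
  then have b: "0 < b"
    using powr_bounds(2)[OF r0] by (simp add: b_def)
  have lim_abs: "((\<lambda>\<mu>. \<bar>f \<mu> x\<bar>) \<longlongrightarrow> b) (nhds \<mu>0)"
    unfolding b_def using x by (intro tendsto_rabs cont) auto
  have "\<forall>\<^sub>F \<mu> in nhds \<mu>0. b / 2 < \<bar>f \<mu> x\<bar>" "\<forall>\<^sub>F \<mu> in nhds \<mu>0. \<bar>f \<mu> x\<bar> < 2 * b"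
    using b by (intro order_tendstoD[OF lim_abs]; simp)+
  then show "\<forall>\<^sub>F \<mu> in nhds \<mu>0. dist (\<alpha> \<mu>) (\<alpha> \<mu>0) < \<delta>"
    using ev
  proof eventually_elim
    case (elim \<mu>)
    have r: "\<bar>f \<mu> x * x powr (- \<alpha> \<mu>) - a\<bar> < \<bar>a\<bar> / 2"
      using elim x by blast
    have "\<bar>a\<bar> * x powr \<alpha> \<mu> \<le> \<bar>a\<bar> * (6 * x powr \<alpha> \<mu>0)" "\<bar>a\<bar> * x powr \<alpha> \<mu>0 \<le> \<bar>a\<bar> * (6 * x powr \<alpha> \<mu>)"
      using powr_bounds[OF r] powr_bounds[OF r0] elim(1,2) by (simp_all add: b_def)
    then have "x powr \<alpha> \<mu> \<le> 6 * x powr \<alpha> \<mu>0" "x powr \<alpha> \<mu>0 \<le> 6 * x powr \<alpha> \<mu>"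
      using a by simp_all
    then have "ln (x powr \<alpha> \<mu>) \<le> ln (6 * x powr \<alpha> \<mu>0)" "ln (x powr \<alpha> \<mu>0) \<le> ln (6 * x powr \<alpha> \<mu>)"
      using x by (intro ln_mono; simp)+
    then have "\<alpha> \<mu> * ln x \<le> ln 6 + \<alpha> \<mu>0 * ln x" "\<alpha> \<mu>0 * ln x \<le> ln 6 + \<alpha> \<mu> * ln x"
      using x by (simp_all add: ln_mult ln_powr)
    then have "\<bar>\<alpha> \<mu> - \<alpha> \<mu>0\<bar> * ln x < \<delta> * ln x"
      using ln6 by (auto simp: abs_if left_diff_distrib)
    then show ?case
      using x by (simp add: dist_real_def)
  qed
qed

lemma eventually_bounded_on_compact_slice:
  fixes f :: "'p::heine_borel \<Rightarrow> real \<Rightarrow> real"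
  assumes "open \<Lambda>" "\<mu>0 \<in> \<Lambda>" "continuous_on ({0..} \<times> \<Lambda>) (\<lambda>(x, \<mu>). f \<mu> x)"
  obtains B where "0 \<le> B" "\<forall>\<^sub>F \<mu> in nhds \<mu>0. \<forall>s\<in>{0..X}. \<bar>f \<mu> s\<bar> \<le> B"
proof -
  obtain e where e: "0 < e" "cball \<mu>0 e \<subseteq> \<Lambda>"
    using assms(1,2) open_contains_cball by blast
  have "compact ((\<lambda>(x, \<mu>). f \<mu> x) ` ({0..X} \<times> cball \<mu>0 e))"
    using e by (intro compact_continuous_image continuous_on_subset[OF assms(3)] compact_Times) auto
  then have "bounded ((\<lambda>(x, \<mu>). f \<mu> x) ` ({0..X} \<times> cball \<mu>0 e))"
    by (rule compact_imp_bounded)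
  then obtain B where B: "0 < B" "\<And>s \<mu>. s \<in> {0..X} \<Longrightarrow> \<mu> \<in> cball \<mu>0 e \<Longrightarrow> \<bar>f \<mu> s\<bar> \<le> B"
    by (fastforce simp: bounded_pos)
  have "\<forall>\<^sub>F \<mu> in nhds \<mu>0. \<mu> \<in> ball \<mu>0 e"
    using e by (intro eventually_nhds_in_open) auto
  then have "\<forall>\<^sub>F \<mu> in nhds \<mu>0. \<forall>s\<in>{0..X}. \<bar>f \<mu> s\<bar> \<le> B"
    by eventually_elim (auto intro: B)
  with B(1) show thesis
    by (intro that[of B]) auto
qed

lemma eventually_power_dominated:
  fixes f :: "'p::heine_borel \<Rightarrow> real \<Rightarrow> real"
  assumes \<Lambda>: "open \<Lambda>" "\<mu>0 \<in> \<Lambda>" "continuous_on ({0..} \<times> \<Lambda>) (\<lambda>(x, \<mu>). f \<mu> x)"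
    and lim: "((\<lambda>(x, \<mu>). f \<mu> x * x powr (- \<gamma> \<mu>)) \<longlongrightarrow> a) (at_top \<times>\<^sub>F nhds \<mu>0)"
    and \<gamma>: "\<forall>\<^sub>F \<mu> in nhds \<mu>0. - real N \<le> \<gamma> \<mu> \<and> \<gamma> \<mu> \<le> 0"
  obtains C where "0 \<le> C" "\<forall>\<^sub>F \<mu> in nhds \<mu>0. power_dominated (f \<mu>) (\<gamma> \<mu>) C"
proof -
  have "\<forall>\<^sub>F (x, \<mu>) in at_top \<times>\<^sub>F nhds \<mu>0. \<bar>f \<mu> x * x powr (- \<gamma> \<mu>) - a\<bar> < 1"
    using tendstoD[OF lim, of 1] by (simp add: dist_real_def case_prod_unfold)
  then obtain X where X: "1 \<le> X"
    and ev: "\<forall>\<^sub>F \<mu> in nhds \<mu>0. \<forall>x\<ge>X. \<bar>f \<mu> x * x powr (- \<gamma> \<mu>) - a\<bar> < 1"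
    by (rule eventually_at_top_prod_nhdsE[where c = 1])
  obtain B where B: "0 \<le> B" "\<forall>\<^sub>F \<mu> in nhds \<mu>0. \<forall>s\<in>{0..X}. \<bar>f \<mu> s\<bar> \<le> B"
    using eventually_bounded_on_compact_slice[OF \<Lambda>] by blast
  \<comment> \<open>Beyond X the limit gives \<bar>a\<bar> + 1. Up to X only the bound B is known;
    on [1,X] it is converted by 1 \<le> X^N s^\<gamma>, because s^\<gamma> \<ge> X^\<gamma> \<ge>
    X^(-N).\<close>
  define C where "C = \<bar>a\<bar> + 1 + B * X ^ N"
  have XN: "1 \<le> X ^ N"
    using X by simp
  have BC: "B \<le> C"
    using mult_left_mono[OF XN B(1)] by (simp add: C_def)
  have "\<forall>\<^sub>F \<mu> in nhds \<mu>0. \<mu> \<in> \<Lambda>"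
    using \<Lambda> by (intro eventually_nhds_in_open)
  with ev B(2) \<gamma> have "\<forall>\<^sub>F \<mu> in nhds \<mu>0. power_dominated (f \<mu>) (\<gamma> \<mu>) C"
  proof eventually_elim
    case (elim \<mu>)
    have "continuous_on {0..} (\<lambda>x. (\<lambda>(x, \<mu>). f \<mu> x) (x, \<mu>))"
      using elim by (intro continuous_on_compose2[OF \<Lambda>(3)] continuous_intros) auto
    moreover have "\<bar>f \<mu> s\<bar> \<le> C * s powr \<gamma> \<mu>" if s: "1 \<le> s" for s
    proof (cases "s \<le> X")
      case True
      have "1 = X ^ N * X powr (- real N)"
        using X by (simp add: powr_minus powr_realpow)
      also have "\<dots> \<le> X ^ N * s powr \<gamma> \<mu>"
      proof (intro mult_left_mono)
        have "X powr (- real N) \<le> X powr \<gamma> \<mu>"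
          using X elim by (intro powr_mono) auto
        also have "\<dots> \<le> s powr \<gamma> \<mu>"
          using s True elim by (intro powr_mono2') auto
        finally show "X powr (- real N) \<le> s powr \<gamma> \<mu>" .
      qed (use X in auto)
      finally have "B * 1 \<le> B * (X ^ N * s powr \<gamma> \<mu>)"
        by (intro mult_left_mono B)
      moreover have "\<bar>f \<mu> s\<bar> \<le> B"
        using elim s True by auto
      moreover have "0 \<le> (\<bar>a\<bar> + 1) * s powr \<gamma> \<mu>"
        by simp
      ultimately show ?thesis
        unfolding C_def distrib_right mult.assoc mult_1_right by linarith
    next
      case False
      then have "\<bar>f \<mu> s * s powr (- \<gamma> \<mu>) - a\<bar> < 1"
        using elim by auto
      then have "\<bar>f \<mu> s * s powr (- \<gamma> \<mu>)\<bar> \<le> \<bar>a\<bar> + 1"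
        by linarith
      also have "\<dots> \<le> C"
        using B XN by (simp add: C_def)
      finally have "\<bar>f \<mu> s * s powr (- \<gamma> \<mu>)\<bar> * s powr \<gamma> \<mu> \<le> C * s powr \<gamma> \<mu>"
        by (intro mult_right_mono) auto
      moreover have "\<bar>f \<mu> s * s powr (- \<gamma> \<mu>)\<bar> * s powr \<gamma> \<mu> = \<bar>f \<mu> s\<bar>"
        using s by (simp add: abs_mult powr_minus)
      ultimately show ?thesis
        by simp
    qed
    moreover have "\<bar>f \<mu> s\<bar> \<le> C" if "s \<in> {0..1}" for s
      using that elim(2) X by (intro order.trans[OF _ BC]) auto
    ultimately show ?case
      by (simp add: power_dominated_def)
  qed
  moreover have "0 \<le> C"
    using B BC by linarith
  ultimately show thesis
    using that by blast
qed

lemma tendsto_ln_exponent_error: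
  fixes \<beta> :: "'p \<Rightarrow> real"
  assumes "(\<beta> \<longlongrightarrow> -1) F"
  shows "((\<lambda>(x, \<mu>). 1 / ln x + \<bar>\<beta> \<mu> + 1\<bar>) \<longlongrightarrow> 0) (at_top \<times>\<^sub>F F)"
proof -
  have ln: "((\<lambda>x::real. 1 / ln x) \<longlongrightarrow> 0) at_top"
    by (intro tendsto_divide_0[OF tendsto_const] filterlim_at_top_imp_at_infinity ln_at_top)
  have 1: "((\<lambda>z. 1 / ln (fst z :: real)) \<longlongrightarrow> 0) (at_top \<times>\<^sub>F F)"
    by (rule filterlim_compose[OF ln filterlim_fst])
  have abs: "((\<lambda>\<mu>. \<bar>\<beta> \<mu> + 1\<bar>) \<longlongrightarrow> \<bar>-1 + 1\<bar>) F"
    by (intro tendsto_intros assms)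
  have "((\<lambda>z. \<bar>\<beta> (snd z) + 1\<bar>) \<longlongrightarrow> \<bar>-1 + 1\<bar>) (at_top \<times>\<^sub>F F)"
    by (rule filterlim_compose[OF abs filterlim_snd])
  from tendsto_add[OF 1 this] show ?thesis
    by (simp add: case_prod_unfold)
qed

text \<open>Half of \<epsilon> pays for the deviation of g from a s^\<beta> beyond X. The fixed
  contribution M, divided by the compensator, is at most M \<open>err\<close> and falls below the
  other half in the joint limit.\<close>

lemma integral_over_compensator_tendsto:
  fixes g :: "'p::heine_borel \<Rightarrow> real \<Rightarrow> real"
  assumes \<Lambda>: "open \<Lambda>" "\<mu>0 \<in> \<Lambda>" "continuous_on ({0..} \<times> \<Lambda>) (\<lambda>(x, \<mu>). g \<mu> x)"
    and lim: "((\<lambda>(x, \<mu>). g \<mu> x * x powr (- \<beta> \<mu>)) \<longlongrightarrow> a) (at_top \<times>\<^sub>F nhds \<mu>0)"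
    and \<beta>: "(\<beta> \<longlongrightarrow> -1) (nhds \<mu>0)"
  shows "((\<lambda>(x, \<mu>). integral {0..x} (g \<mu>) / compensator x (\<beta> \<mu>)) \<longlongrightarrow> a) (at_top \<times>\<^sub>F nhds \<mu>0)"
proof (rule tendstoI)
  fix \<epsilon> :: real assume \<epsilon>: "0 < \<epsilon>"
  define err where "err x \<mu> = 1 / ln x + \<bar>\<beta> \<mu> + 1\<bar>" for x \<mu>
  have "\<forall>\<^sub>F (x, \<mu>) in at_top \<times>\<^sub>F nhds \<mu>0. \<bar>g \<mu> x * x powr (- \<beta> \<mu>) - a\<bar> < \<epsilon> / 2"
    using tendstoD[OF lim, of "\<epsilon> / 2"] \<epsilon> by (simp add: dist_real_def case_prod_unfold)
  then obtain X where X: "1 \<le> X"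
    and ev: "\<forall>\<^sub>F \<mu> in nhds \<mu>0. \<forall>x\<ge>X. \<bar>g \<mu> x * x powr (- \<beta> \<mu>) - a\<bar> < \<epsilon> / 2"
    by (rule eventually_at_top_prod_nhdsE[where c = 1])
  obtain B where B: "0 \<le> B" "\<forall>\<^sub>F \<mu> in nhds \<mu>0. \<forall>s\<in>{0..X}. \<bar>g \<mu> s\<bar> \<le> B"
    using eventually_bounded_on_compact_slice[OF \<Lambda>] by blast
  define M where "M = (B + \<bar>a\<bar>) * X"
  have M: "0 \<le> M"
    using B X by (simp add: M_def)
  have "\<forall>\<^sub>F \<mu> in nhds \<mu>0. \<beta> \<mu> < 0"
    using \<beta> by (rule order_tendstoD) simp
  moreover have "\<forall>\<^sub>F \<mu> in nhds \<mu>0. \<mu> \<in> \<Lambda>"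
    using \<Lambda> by (intro eventually_nhds_in_open)
  ultimately have "\<forall>\<^sub>F \<mu> in nhds \<mu>0. \<forall>x\<ge>X. 1 < x \<longrightarrow>
      \<bar>integral {0..x} (g \<mu>) / compensator x (\<beta> \<mu>) - a\<bar> \<le> \<epsilon> / 2 + M * err x \<mu>"
    using ev B(2)
  proof eventually_elim
    case (elim \<mu>)
    have "continuous_on {0..} (\<lambda>x. (\<lambda>(x, \<mu>). g \<mu> x) (x, \<mu>))"
      using elim by (intro continuous_on_compose2[OF \<Lambda>(3)] continuous_intros) auto
    then have cont: "continuous_on {0..} (g \<mu>)"
      by simp
    have near: "\<bar>g \<mu> s - a * s powr \<beta> \<mu>\<bar> \<le> \<epsilon> / 2 * s powr \<beta> \<mu>" if s: "X \<le> s" for s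
    proof -
      have "g \<mu> s - a * s powr \<beta> \<mu> = (g \<mu> s * s powr (- \<beta> \<mu>) - a) * s powr \<beta> \<mu>"
        using s X by (simp add: left_diff_distrib powr_minus)
      also have "\<bar>\<dots>\<bar> = \<bar>g \<mu> s * s powr (- \<beta> \<mu>) - a\<bar> * s powr \<beta> \<mu>"
        by (simp add: abs_mult)
      also have "\<dots> \<le> \<epsilon> / 2 * s powr \<beta> \<mu>"
        using elim s by (intro mult_right_mono) (auto intro: less_imp_le)
      finally show ?thesis .
    qed
    show ?case
    proof (intro allI impI)
      fix x assume x: "X \<le> x" "1 < x"
      let ?w = "compensator x (\<beta> \<mu>)"
      have w: "0 < ?w" "1 / ?w \<le> err x \<mu>"
        using inverse_compensator_bound[OF x(2)] by (auto simp: err_def)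
      have "\<bar>integral {0..x} (g \<mu>) - a * ?w\<bar> \<le> \<epsilon> / 2 * ?w + M"
        unfolding M_def using elim \<epsilon> near
        by (intro integral_compensator_approx[OF cont X x(1)]) auto
      then have "\<bar>integral {0..x} (g \<mu>) - a * ?w\<bar> / ?w \<le> (\<epsilon> / 2 * ?w + M) / ?w"
        using w by (intro divide_right_mono) auto
      moreover have "integral {0..x} (g \<mu>) / ?w - a = (integral {0..x} (g \<mu>) - a * ?w) / ?w"
        using w by (simp add: diff_divide_distrib)
      then have "\<bar>integral {0..x} (g \<mu>) / ?w - a\<bar> = \<bar>integral {0..x} (g \<mu>) - a * ?w\<bar> / ?w"
        using w by (simp only: abs_divide abs_of_pos)
      moreover have "(\<epsilon> / 2 * ?w + M) / ?w = \<epsilon> / 2 + M * (1 / ?w)"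
        using w by (simp add: add_divide_distrib)
      ultimately show "\<bar>integral {0..x} (g \<mu>) / ?w - a\<bar> \<le> \<epsilon> / 2 + M * err x \<mu>"
        using mult_left_mono[OF w(2) M] by linarith
    qed
  qed
  then have 1: "\<forall>\<^sub>F z in at_top \<times>\<^sub>F nhds \<mu>0. \<forall>x\<ge>X. 1 < x \<longrightarrow>
      \<bar>integral {0..x} (g (snd z)) / compensator x (\<beta> (snd z)) - a\<bar> \<le> \<epsilon> / 2 + M * err x (snd z)"
    by (rule eventually_compose_filterlim[OF _ filterlim_snd])
  have 2: "\<forall>\<^sub>F z in at_top \<times>\<^sub>F nhds \<mu>0. max X 2 \<le> fst z"
    by (rule eventually_compose_filterlim[OF eventually_ge_at_top filterlim_fst])
  have "((\<lambda>z. M * err (fst z) (snd z)) \<longlongrightarrow> M * 0) (at_top \<times>\<^sub>F nhds \<mu>0)"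
    using tendsto_ln_exponent_error[OF \<beta>] by (intro tendsto_mult_left) (simp add: err_def case_prod_unfold)
  then have "\<forall>\<^sub>F z in at_top \<times>\<^sub>F nhds \<mu>0. M * err (fst z) (snd z) < \<epsilon> / 2"
    using \<epsilon> by (intro order_tendstoD) auto
  with 1 2 show "\<forall>\<^sub>F z in at_top \<times>\<^sub>F nhds \<mu>0.
      dist (case z of (x, \<mu>) \<Rightarrow> integral {0..x} (g \<mu>) / compensator x (\<beta> \<mu>)) a < \<epsilon>"
  proof eventually_elim
    case (elim z)
    then have "\<bar>integral {0..fst z} (g (snd z)) / compensator (fst z) (\<beta> (snd z)) - a\<bar>
        \<le> \<epsilon> / 2 + M * err (fst z) (snd z)"
      by auto
    with elim(3) show ?case
      by (simp add: case_prod_unfold dist_real_def)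
  qed
qed

section \<open>Asymptotics of the transform at resonance\<close>

theorem theorem3:
  fixes \<Lambda> :: "(real ^ 'd) set"
    and f :: "real ^ 'd \<Rightarrow> real \<Rightarrow> real"
    and a \<alpha> :: "real ^ 'd \<Rightarrow> real"
    and \<mu>0 :: "real ^ 'd"
    and m :: nat
  assumes "open \<Lambda>" and "\<mu>0 \<in> \<Lambda>"
    and "continuous_on ({0..} \<times> \<Lambda>) (\<lambda>(x, \<mu>). f \<mu> x)"
    and "\<And>\<mu>. \<mu> \<in> \<Lambda> \<Longrightarrow> analytic_halfline (f \<mu>)"
    and "quantified_by_powers \<Lambda> f a \<alpha> \<mu>0"
    and "\<alpha> \<mu>0 + 2 * real m = -1"
    and "\<And>n \<mu>. n \<in> {1..m} \<Longrightarrow> \<mu> \<in> \<Lambda> \<Longrightarrow> momentum_exists n (f \<mu>) \<Longrightarrow> momentum n (f \<mu>) = 0"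
  shows "quantified_by_Omega (\<lambda>\<mu> x. x ^ (2 * m + 1) * F_op (f \<mu>) x)
           (\<lambda>\<mu>. a \<mu> * b_coeff m (\<alpha> \<mu>)) (\<lambda>\<mu>. \<alpha> \<mu> + 2 * real m) \<mu>0"
proof -
  note \<Lambda> = assms(1-3) and mom = assms(7)
  let ?N = "at_top \<times>\<^sub>F nhds \<mu>0 :: (real \<times> (real ^ 'd)) filter"
  define \<beta> where "\<beta> \<mu> = \<alpha> \<mu> + 2 * real m" for \<mu>
  define c where "c = inv_sqrt_coeff m"
  define g where "g \<mu> x = x ^ (2*m) * f \<mu> x" for \<mu> x
  have lim: "((\<lambda>(x, \<mu>). f \<mu> x * x powr (- \<alpha> \<mu>)) \<longlongrightarrow> a \<mu>0) ?N" and a0: "a \<mu>0 \<noteq> 0"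
    using assms(5) by (auto simp: quantified_by_powers_def)
  have \<alpha>0: "\<alpha> \<mu>0 = - 1 - 2 * real m"
    using assms(6) by linarith
  have ev\<Lambda>: "\<forall>\<^sub>F \<mu> in nhds \<mu>0. \<mu> \<in> \<Lambda>"
    using \<Lambda> by (intro eventually_nhds_in_open)
  have "((\<lambda>\<mu>. f \<mu> x) \<longlongrightarrow> f \<mu>0 x) (nhds \<mu>0)" if "0 \<le> x" for x
  proof -
    have "continuous_on \<Lambda> (\<lambda>\<mu>. (\<lambda>(x, \<mu>). f \<mu> x) (x, \<mu>))"
      using that by (intro continuous_on_compose2[OF \<Lambda>(3)] continuous_intros) auto
    then have "isCont (\<lambda>\<mu>. f \<mu> x) \<mu>0"
      using \<Lambda> by (simp add: continuous_on_eq_continuous_at)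
    then show ?thesis
      using tendsto_at_iff_tendsto_nhds[of "\<lambda>\<mu>. f \<mu> x" \<mu>0] by (simp add: isCont_def)
  qed
  then have "(\<alpha> \<longlongrightarrow> \<alpha> \<mu>0) (nhds \<mu>0)"
    using exponent_tendsto[of f \<alpha> "a \<mu>0" \<mu>0, OF lim a0] by simp
  then have "((\<lambda>\<mu>. \<alpha> \<mu> + 2 * real m) \<longlongrightarrow> \<alpha> \<mu>0 + 2 * real m) (nhds \<mu>0)"
    by (intro tendsto_add tendsto_const)
  then have \<beta>: "(\<beta> \<longlongrightarrow> -1) (nhds \<mu>0)"
    by (simp add: \<beta>_def[abs_def] assms(6))
  have "\<forall>\<^sub>F \<mu> in nhds \<mu>0. - 3/2 < \<beta> \<mu>" "\<forall>\<^sub>F \<mu> in nhds \<mu>0. \<beta> \<mu> < - 1/2"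
    by (intro order_tendstoD[OF \<beta>]; simp)+
  then have ev\<beta>: "\<forall>\<^sub>F \<mu> in nhds \<mu>0. - 3/2 \<le> \<beta> \<mu> \<and> \<beta> \<mu> \<le> - 1/2"
    by eventually_elim auto
  \<comment> \<open>Since \<alpha> = \<beta> - 2m and \<beta> \<ge> -3/2, the integer N = 2m+2
    bounds the decay exponent.\<close>
  then have "\<forall>\<^sub>F \<mu> in nhds \<mu>0. - real (2*m+2) \<le> \<alpha> \<mu> \<and> \<alpha> \<mu> \<le> 0"
    by eventually_elim (auto simp: \<beta>_def)
  then obtain C where C: "0 \<le> C" "\<forall>\<^sub>F \<mu> in nhds \<mu>0. power_dominated (f \<mu>) (\<alpha> \<mu>) C"
    using eventually_power_dominated[OF \<Lambda> lim] by blast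
  obtain K where K: "0 \<le> K"
    "\<And>f \<beta> C x. power_dominated f (\<beta> - 2 * real m) C \<Longrightarrow> - 3/2 \<le> \<beta> \<Longrightarrow> \<beta> \<le> - 1/2 \<Longrightarrow> 2 \<le> x \<Longrightarrow>
       (\<And>n. n \<in> {1..m} \<Longrightarrow> momentum_exists n f \<Longrightarrow> momentum n f = 0) \<Longrightarrow>
       \<bar>x ^ (2*m+1) * F_op f x - inv_sqrt_coeff m * integral {0..x} (\<lambda>s. s ^ (2*m) * f s)\<bar>
         \<le> K * C * (1 + x powr (\<beta> + 1))"
    using F_op_approx_moment[of m] by blast
  define P where "P x \<mu> = x ^ (2*m+1) * F_op (f \<mu>) x" for x \<mu>
  define err where "err x \<mu> = 1 / ln x + \<bar>\<beta> \<mu> + 1\<bar>" for x \<mu>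
  \<comment> \<open>After division by the compensator, P and c times the truncated moment agree up
    to a multiple of \<open>err\<close>, with K and C independent of \<mu>.\<close>
  have ev_diff: "\<forall>\<^sub>F \<mu> in nhds \<mu>0. \<forall>x\<ge>2.
      \<bar>P x \<mu> / compensator x (\<beta> \<mu>) - c * (integral {0..x} (g \<mu>) / compensator x (\<beta> \<mu>))\<bar>
        \<le> K * C * 2 * err x \<mu>"
    using ev\<Lambda> ev\<beta> C(2)
  proof eventually_elim
    case (elim \<mu>)
    show ?case
    proof (intro allI impI)
      fix x :: real assume x: "2 \<le> x"
      let ?w = "compensator x (\<beta> \<mu>)"
      have w: "0 < ?w" "(1 + x powr (\<beta> \<mu> + 1)) / ?w \<le> 2 * err x \<mu>"
        using x inverse_compensator_bound(1)[of x] powr_over_compensator_bound[of x] by (auto simp: err_def)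
      have "power_dominated (f \<mu>) (\<beta> \<mu> - 2 * real m) C"
        using elim by (simp add: \<beta>_def)
      then have "\<bar>P x \<mu> - c * integral {0..x} (g \<mu>)\<bar> \<le> K * C * (1 + x powr (\<beta> \<mu> + 1))"
        unfolding P_def c_def g_def using elim x mom by (intro K(2)) auto
      then have "\<bar>P x \<mu> - c * integral {0..x} (g \<mu>)\<bar> / ?w \<le> K * C * ((1 + x powr (\<beta> \<mu> + 1)) / ?w)"
        using w divide_right_mono by fastforce
      also have "\<dots> \<le> K * C * (2 * err x \<mu>)"
        using w K C by (intro mult_left_mono) auto
      also have "\<bar>P x \<mu> - c * integral {0..x} (g \<mu>)\<bar> / ?w = \<bar>(P x \<mu> - c * integral {0..x} (g \<mu>)) / ?w\<bar>"
        using w by (simp only: abs_divide abs_of_pos)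
      also have "(P x \<mu> - c * integral {0..x} (g \<mu>)) / ?w = P x \<mu> / ?w - c * (integral {0..x} (g \<mu>) / ?w)"
        by (simp add: diff_divide_distrib)
      finally show "\<bar>P x \<mu> / ?w - c * (integral {0..x} (g \<mu>) / ?w)\<bar> \<le> K * C * 2 * err x \<mu>"
        by (simp only: mult.assoc)
    qed
  qed
  have 1: "\<forall>\<^sub>F z in ?N. \<forall>x\<ge>2. \<bar>P x (snd z) / compensator x (\<beta> (snd z))
      - c * (integral {0..x} (g (snd z)) / compensator x (\<beta> (snd z)))\<bar> \<le> K * C * 2 * err x (snd z)"
    by (rule eventually_compose_filterlim[OF ev_diff filterlim_snd])
  have 2: "\<forall>\<^sub>F z in ?N. 2 \<le> fst z"
    by (rule eventually_compose_filterlim[OF eventually_ge_at_top filterlim_fst])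
  have err: "((\<lambda>z. K * C * 2 * err (fst z) (snd z)) \<longlongrightarrow> 0) ?N"
    using tendsto_ln_exponent_error[OF \<beta>]
    by (intro tendsto_mult_right_zero) (simp add: err_def case_prod_unfold)
  have diff: "((\<lambda>z. P (fst z) (snd z) / compensator (fst z) (\<beta> (snd z))
      - c * (integral {0..fst z} (g (snd z)) / compensator (fst z) (\<beta> (snd z)))) \<longlongrightarrow> 0) ?N"
    by (rule Lim_null_comparison[OF _ err]) (use 1 2 in eventually_elim, simp)
  \<comment> \<open>The factor x^(2m) shifts the exponent from \<alpha> to \<beta>; rewriting it as
    a real power needs x > 0, so the two expressions are compared only eventually.\<close>
  have "((\<lambda>(x, \<mu>). g \<mu> x * x powr (- \<beta> \<mu>)) \<longlongrightarrow> a \<mu>0) ?N"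
  proof (rule Lim_transform_eventually[OF lim])
    show "\<forall>\<^sub>F z in ?N. (case z of (x, \<mu>) \<Rightarrow> f \<mu> x * x powr (- \<alpha> \<mu>))
        = (case z of (x, \<mu>) \<Rightarrow> g \<mu> x * x powr (- \<beta> \<mu>))"
      using 2
    proof eventually_elim
      case (elim z)
      obtain x \<mu> where z: "z = (x, \<mu>)"
        by (cases z)
      have "x powr (- \<alpha> \<mu>) = x powr (real (2*m) + - \<beta> \<mu>)"
        by (simp add: \<beta>_def)
      also have "\<dots> = x ^ (2*m) * x powr (- \<beta> \<mu>)"
        using elim z by (subst powr_add, subst powr_realpow) auto
      finally show ?case
        by (simp add: z g_def mult_ac)
    qed
  qed
  moreover have "continuous_on ({0..} \<times> \<Lambda>) (\<lambda>(x, \<mu>). g \<mu> x)"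
    using continuous_on_mult[OF continuous_on_power[OF continuous_on_fst[OF continuous_on_id]] \<Lambda>(3), of "2*m"]
    by (simp add: g_def case_prod_unfold)
  ultimately have "((\<lambda>(x, \<mu>). integral {0..x} (g \<mu>) / compensator x (\<beta> \<mu>)) \<longlongrightarrow> a \<mu>0) ?N"
    using \<Lambda>(1,2) \<beta> by (intro integral_over_compensator_tendsto)
  then have "((\<lambda>z. c * (integral {0..fst z} (g (snd z)) / compensator (fst z) (\<beta> (snd z)))) \<longlongrightarrow> c * a \<mu>0) ?N"
    by (intro tendsto_mult_left) (simp add: case_prod_unfold)
  from tendsto_add[OF diff this]
  have "((\<lambda>z. P (fst z) (snd z) / compensator (fst z) (\<beta> (snd z))) \<longlongrightarrow> c * a \<mu>0) ?N"
    by simp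
  moreover have "((\<lambda>z. if \<beta> (snd z) = -1 then 1 else (\<beta> (snd z) + 1) * G_fun (\<beta> (snd z))) \<longlongrightarrow> 1) ?N"
    by (rule filterlim_compose[OF tendsto_Omega_factor filterlim_compose[OF \<beta> filterlim_snd]])
  ultimately have "((\<lambda>z. P (fst z) (snd z) / compensator (fst z) (\<beta> (snd z)) /
      (if \<beta> (snd z) = -1 then 1 else (\<beta> (snd z) + 1) * G_fun (\<beta> (snd z)))) \<longlongrightarrow> c * a \<mu>0 / 1) ?N"
    by (rule tendsto_divide) simp
  \<comment> \<open>The limit demanded by \<open>quantified_by_Omega\<close> is the value at \<mu>0,
    so \<open>b_coeff\<close> is evaluated exactly at resonance.\<close>
  moreover have "b_coeff m (\<alpha> \<mu>0) = c"
    by (simp add: \<alpha>0 b_coeff_at_resonance c_def)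
  ultimately show ?thesis
    using a0 inv_sqrt_coeff_pos[of m]
    by (simp add: quantified_by_Omega_def case_prod_unfold Omega_def P_def \<beta>_def c_def mult_ac cong: if_cong)
qed

end
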